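(* Let $T>0$, $0<\eta<T$, $2<\alpha\le 3$, $\beta_0=0$, $0<\beta_1\le 1$, $1<\beta_2\le 2$, and let $a_i,b_i,\lambda_i\in\mathbb{R}$ ($i=0,1,2$) satisfy $$a_0+b_0\neq 0,\qquad a_1\eta^{1-\beta_1}+b_1T^{1-\beta_1}\neq 0,\qquad a_i\eta^{2-\beta_i}+b_iT^{2-\beta_i}\neq 0\ \ (i=1,2).$$ Assume: (1) $f:[0,T]\times\mathbb{R}\times\mathbb{R}\times\mathbb{R}\to\mathbb{R}$ is jointly continuous. (2) There exist $\tau\in(0,\min(1,\alpha-\beta_2))$ and $l_f\in L^{1/\tau}([0,T];\mathbb{R}^+)$ such that $$|f(t,u_1,u_2,u_3)-f(t,v_1,v_2,v_3)|\le l_f(t)\big(|u_1-v_1|+|u_2-v_2|+|u_3-v_3|\big)$$ for all $(t,u_1,u_2,u_3),(t,v_1,v_2,v_3)\in[0,T]\times\mathbb{R}^3$. (3) For $i=0,1,2$, $g_i:[0,T]\times\mathbb{R}\to\mathbb{R}$ is jointly continuous and there exists $l_{g_i}\in L^1([0,T];\mathbb{R}^+)$ such that $|g_i(t,u)-g_i(t,v)|\le l_{g_i}(t)|u-v|$ for all $(t,u),(t,v)\in[0,T]\times\mathbb{R}$. If $$(\Delta_0+\Delta_1+\Delta_2)\|l_f\|_{1/\tau}+\sum_{i=0}^{2}\rho_i|\lambda_i|\,\|l_{g_i}\|_1+\sum_{i=1}^{2}\widetilde\rho_i|\lambda_i|\,\|l_{g_i}\|_1+\widehat\rho_2|\lambda_2|\,\|l_{g_2}\|_1<1,$$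 where the constants $\Delta_i,\rho_i,\widetilde\rho_i,\widehat\rho_i$ are those defined in the context, then the boundary value problem $$\mathfrak{D}_{0^+}^{\alpha}u(t)=f\big(t,u(t),\mathfrak{D}_{0^+}^{\beta_1}u(t),\mathfrak{D}_{0^+}^{\beta_2}u(t)\big),\qquad 0\le t\le T,$$ $$a_0u(0)+b_0u(T)=\lambda_0\int_0^T g_0(s,u(s))\,ds,$$ $$a_1\mathfrak{D}_{0^+}^{\beta_1}u(\eta)+b_1\mathfrak{D}_{0^+}^{\beta_1}u(T)=\lambda_1\int_0^T g_1(s,u(s))\,ds,$$ $$a_2\mathfrak{D}_{0^+}^{\beta_2}u(\eta)+b_2\mathfrak{D}_{0^+}^{\beta_2}u(T)=\lambda_2\int_0^T g_2(s,u(s))\,ds$$ has a unique solution on $[0,T]$.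
   Context: $\mathbb{R}^+$ denotes the nonnegative reals; $\|\cdot\|_{p}$ is the norm of $L^p([0,T])$. Riemann–Liouville integral: for $\gamma>0$ and continuous $h$, $I_{0^+}^{\gamma}h(t)=\frac{1}{\Gamma(\gamma)}\int_0^t(t-s)^{\gamma-1}h(s)\,ds$. Caputo derivative: for $\gamma>0$ and $n=\lceil\gamma\rceil$, an $n$-times continuously differentiable $u$ on $[0,T]$ has $\mathfrak{D}_{0^+}^{\gamma}u(t)=\frac{1}{\Gamma(n-\gamma)}\int_0^t(t-s)^{n-\gamma-1}u^{(n)}(s)\,ds$ if $n-1<\gamma<n$, and $\mathfrak{D}_{0^+}^{\gamma}u=u^{(n)}$ if $\gamma=n$. Meaning of the equation: for $2<\alpha\le3$ and continuous $h$ on $[0,T]$, "$\mathfrak{D}_{0^+}^{\alpha}u=h$ on $[0,T]$" means that $u(t)=I_{0^+}^{\alpha}h(t)-k_0-k_1t-k_2t^2$ for all $t\in[0,T]$, for some constants $k_0,k_1,k_2\in\mathbb{R}$; such $u$ are twice continuously differentiable. A solution of the boundary value problem is a twice continuously differentiable $u:[0,T]\to\mathbb{R}$ satisfying the equation in this sense with $h(t)=f(t,u(t),\mathfrak{D}_{0^+}^{\beta_1}u(t),\mathfrak{D}_{0^+}^{\beta_2}u(t))$, together with the three boundary conditions. Constants (superscripts on $\mu,\nu$ are labels, not powers): $$\mu^{\beta_1}=\frac{\Gamma(3-\beta_1)}{2(a_1\eta^{2-\beta_1}+b_1T^{2-\beta_1})},\quad \mu^{\beta_2}=\frac{\Gamma(3-\beta_2)}{2(a_2\eta^{2-\beta_2}+b_2T^{2-\beta_2})},\quad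 \nu^{\beta_1}=\frac{\Gamma(2-\beta_1)}{a_1\eta^{1-\beta_1}+b_1T^{1-\beta_1}},$$ $$\rho_0=\frac{1}{|a_0+b_0|},\qquad \rho_1=|\nu^{\beta_1}|\Big(\frac{|b_0|}{|a_0+b_0|}+1\Big)T,$$ $$\rho_2=\frac{|b_0||\mu^{\beta_2}|}{|a_0+b_0|}T^2+\frac{|b_0||\nu^{\beta_1}|}{|a_0+b_0|}\frac{|\mu^{\beta_2}|}{|\mu^{\beta_1}|}T+\frac{|\nu^{\beta_1}||\mu^{\beta_2}|}{|\mu^{\beta_1}|}T+|\mu^{\beta_2}|T^2,$$ $$\widetilde\rho_0=0,\qquad \widetilde\rho_1=\frac{|\nu^{\beta_1}|T^{1-\beta_1}}{\Gamma(2-\beta_1)},\qquad \widetilde\rho_2=\frac{|\mu^{\beta_2}||\nu^{\beta_1}|T^{1-\beta_1}}{|\mu^{\beta_1}|\Gamma(2-\beta_1)}+2\frac{|\mu^{\beta_2}|T^{2-\beta_1}}{\Gamma(3-\beta_1)},$$ $$\widehat\rho_0=\widehat\rho_1=0,\qquad \widehat\rho_2=2\frac{|\mu^{\beta_2}|T^{2-\beta_2}}{\Gamma(3-\beta_2)},$$ $$\Delta_0=\frac{T^{\alpha-\tau}}{\Gamma(\alpha)}\Big(\frac{1-\tau}{\alpha-\tau}\Big)^{1-\tau}+\sum_{i=0}^{2}\rho_i\Big(|b_i|\frac{T^{\alpha-\beta_i-\tau}}{\Gamma(\alpha-\beta_i)}+|a_i|\frac{\eta^{\alpha-\beta_i-\tau}}{\Gamma(\alpha-\beta_i)}\Big)\Big(\frac{1-\tau}{\alpha-\beta_i-\tau}\Big)^{1-\tau},$$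 $$\Delta_1=\frac{T^{\alpha-\beta_1-\tau}}{\Gamma(\alpha-\beta_1)}\Big(\frac{1-\tau}{\alpha-\beta_1-\tau}\Big)^{1-\tau}+\sum_{i=1}^{2}\widetilde\rho_i\Big(|b_i|\frac{T^{\alpha-\beta_i-\tau}}{\Gamma(\alpha-\beta_i)}+|a_i|\frac{\eta^{\alpha-\beta_i-\tau}}{\Gamma(\alpha-\beta_i)}\Big)\Big(\frac{1-\tau}{\alpha-\beta_i-\tau}\Big)^{1-\tau},$$ $$\Delta_2=\frac{T^{\alpha-\beta_2-\tau}}{\Gamma(\alpha-\beta_2)}\Big(\frac{1-\tau}{\alpha-\beta_2-\tau}\Big)^{1-\tau}+\widehat\rho_2\Big(|b_2|\frac{T^{\alpha-\beta_2-\tau}}{\Gamma(\alpha-\beta_2)}+|a_2|\frac{\eta^{\alpha-\beta_2-\tau}}{\Gamma(\alpha-\beta_2)}\Big)\Big(\frac{1-\tau}{\alpha-\beta_2-\tau}\Big)^{1-\tau}.$$ *)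

theory Defs
  imports "HOL-Analysis.Analysis"
begin

text \<open>
  Functions on \<open>[0,T]\<close> are represented by total functions whose values outside \<open>{0..T}\<close> are
  irrelevant; derivatives are taken within \<open>{0..T}\<close>, hence one-sided at the end points.
\<close>

definition nderiv_on :: "real \<Rightarrow> nat \<Rightarrow> (real \<Rightarrow> real) \<Rightarrow> real \<Rightarrow> real" where
  "nderiv_on T n u = ((\<lambda>v t. vector_derivative v (at t within {0..T})) ^^ n) u"

definition cont_diff_on :: "real \<Rightarrow> nat \<Rightarrow> (real \<Rightarrow> real) \<Rightarrow> bool" where
  "cont_diff_on T n u \<longleftrightarrow>
     (\<forall>k<n. \<forall>t\<in>{0..T}. nderiv_on T k u differentiable (at t within {0..T})) \<and>
     continuous_on {0..T} (nderiv_on T n u)"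

definition RL_integral :: "real \<Rightarrow> (real \<Rightarrow> real) \<Rightarrow> real \<Rightarrow> real" where
  "RL_integral \<gamma> h t =
     1 / Gamma \<gamma> * (LINT s:{0..t}|lebesgue. (t - s) powr (\<gamma> - 1) * h s)"

definition caputo :: "real \<Rightarrow> real \<Rightarrow> (real \<Rightarrow> real) \<Rightarrow> real \<Rightarrow> real" where
  "caputo T \<gamma> u t =
     (let n = nat \<lceil>\<gamma>\<rceil> in
      if \<gamma> = real n then nderiv_on T n u t
      else 1 / Gamma (real n - \<gamma>) *
           (LINT s:{0..t}|lebesgue. (t - s) powr (real n - \<gamma> - 1) * nderiv_on T n u s))"

text \<open>
  The equation of order \<open>\<alpha>\<close> with \<open>2 < \<alpha> \<le> 3\<close> and continuous right-hand side \<open>h\<close> is understood in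
  integrated form, as a solution need not be three times differentiable.
\<close>

definition solves_caputo_eq :: "real \<Rightarrow> real \<Rightarrow> (real \<Rightarrow> real) \<Rightarrow> (real \<Rightarrow> real) \<Rightarrow> bool" where
  "solves_caputo_eq T \<alpha> h u \<longleftrightarrow>
     (\<exists>k0 k1 k2. \<forall>t\<in>{0..T}. u t = RL_integral \<alpha> h t - k0 - k1 * t - k2 * t\<^sup>2)"

definition bvp_solution ::
  "real \<Rightarrow> real \<Rightarrow> real \<Rightarrow> (nat \<Rightarrow> real) \<Rightarrow> (nat \<Rightarrow> real) \<Rightarrow> (nat \<Rightarrow> real) \<Rightarrow> (nat \<Rightarrow> real) \<Rightarrow>
   (real \<times> real \<times> real \<times> real \<Rightarrow> real) \<Rightarrow> (nat \<Rightarrow> real \<times> real \<Rightarrow> real) \<Rightarrow> (real \<Rightarrow> real) \<Rightarrow> bool" where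
  "bvp_solution T \<eta> \<alpha> \<beta> a b lam f g u \<longleftrightarrow>
     cont_diff_on T 2 u \<and>
     solves_caputo_eq T \<alpha> (\<lambda>t. f (t, u t, caputo T (\<beta> 1) u t, caputo T (\<beta> 2) u t)) u \<and>
     a 0 * u 0 + b 0 * u T = lam 0 * (LINT s:{0..T}|lebesgue. g 0 (s, u s)) \<and>
     a 1 * caputo T (\<beta> 1) u \<eta> + b 1 * caputo T (\<beta> 1) u T =
       lam 1 * (LINT s:{0..T}|lebesgue. g 1 (s, u s)) \<and>
     a 2 * caputo T (\<beta> 2) u \<eta> + b 2 * caputo T (\<beta> 2) u T =
       lam 2 * (LINT s:{0..T}|lebesgue. g 2 (s, u s))"

definition in_Lp :: "real \<Rightarrow> real \<Rightarrow> (real \<Rightarrow> real) \<Rightarrow> bool" where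
  "in_Lp T p l \<longleftrightarrow>
     set_borel_measurable lebesgue {0..T} l \<and>
     set_integrable lebesgue {0..T} (\<lambda>s. \<bar>l s\<bar> powr p)"

definition Lp_norm :: "real \<Rightarrow> real \<Rightarrow> (real \<Rightarrow> real) \<Rightarrow> real" where
  "Lp_norm T p l = (LINT s:{0..T}|lebesgue. \<bar>l s\<bar> powr p) powr (1 / p)"

text \<open>
  Below, \<open>\<mu> T \<eta> \<beta> a b i\<close> is $\mu^{\beta_i}$ (for \<open>i = 1, 2\<close>) and \<open>\<nu> T \<eta> \<beta> a b\<close> is $\nu^{\beta_1}$.
\<close>

definition \<mu> :: "real \<Rightarrow> real \<Rightarrow> (nat \<Rightarrow> real) \<Rightarrow> (nat \<Rightarrow> real) \<Rightarrow> (nat \<Rightarrow> real) \<Rightarrow> nat \<Rightarrow> real" where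
  "\<mu> T \<eta> \<beta> a b i =
     Gamma (3 - \<beta> i) / (2 * (a i * \<eta> powr (2 - \<beta> i) + b i * T powr (2 - \<beta> i)))"

definition \<nu> :: "real \<Rightarrow> real \<Rightarrow> (nat \<Rightarrow> real) \<Rightarrow> (nat \<Rightarrow> real) \<Rightarrow> (nat \<Rightarrow> real) \<Rightarrow> real" where
  "\<nu> T \<eta> \<beta> a b =
     Gamma (2 - \<beta> 1) / (a 1 * \<eta> powr (1 - \<beta> 1) + b 1 * T powr (1 - \<beta> 1))"

definition rho :: "real \<Rightarrow> real \<Rightarrow> (nat \<Rightarrow> real) \<Rightarrow> (nat \<Rightarrow> real) \<Rightarrow> (nat \<Rightarrow> real) \<Rightarrow> nat \<Rightarrow> real" where
  "rho T \<eta> \<beta> a b i =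
     (let \<mu>1 = \<bar>\<mu> T \<eta> \<beta> a b 1\<bar>; \<mu>2 = \<bar>\<mu> T \<eta> \<beta> a b 2\<bar>; \<nu>1 = \<bar>\<nu> T \<eta> \<beta> a b\<bar> in
      if i = 0 then 1 / \<bar>a 0 + b 0\<bar>
      else if i = 1 then \<nu>1 * (\<bar>b 0\<bar> / \<bar>a 0 + b 0\<bar> + 1) * T
      else if i = 2 then
        \<bar>b 0\<bar> * \<mu>2 / \<bar>a 0 + b 0\<bar> * T\<^sup>2 + \<bar>b 0\<bar> * \<nu>1 / \<bar>a 0 + b 0\<bar> * (\<mu>2 / \<mu>1) * T
        + \<nu>1 * \<mu>2 / \<mu>1 * T + \<mu>2 * T\<^sup>2
      else 0)"

definition rho_tilde ::
  "real \<Rightarrow> real \<Rightarrow> (nat \<Rightarrow> real) \<Rightarrow> (nat \<Rightarrow> real) \<Rightarrow> (nat \<Rightarrow> real) \<Rightarrow> nat \<Rightarrow> real" where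
  "rho_tilde T \<eta> \<beta> a b i =
     (let \<mu>1 = \<bar>\<mu> T \<eta> \<beta> a b 1\<bar>; \<mu>2 = \<bar>\<mu> T \<eta> \<beta> a b 2\<bar>; \<nu>1 = \<bar>\<nu> T \<eta> \<beta> a b\<bar> in
      if i = 1 then \<nu>1 * T powr (1 - \<beta> 1) / Gamma (2 - \<beta> 1)
      else if i = 2 then
        \<mu>2 * \<nu>1 * T powr (1 - \<beta> 1) / (\<mu>1 * Gamma (2 - \<beta> 1))
        + 2 * (\<mu>2 * T powr (2 - \<beta> 1) / Gamma (3 - \<beta> 1))
      else 0)"

definition rho_hat ::
  "real \<Rightarrow> real \<Rightarrow> (nat \<Rightarrow> real) \<Rightarrow> (nat \<Rightarrow> real) \<Rightarrow> (nat \<Rightarrow> real) \<Rightarrow> nat \<Rightarrow> real" where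
  "rho_hat T \<eta> \<beta> a b i =
     (if i = 2 then 2 * (\<bar>\<mu> T \<eta> \<beta> a b 2\<bar> * T powr (2 - \<beta> 2) / Gamma (3 - \<beta> 2)) else 0)"

definition bdry_term ::
  "real \<Rightarrow> real \<Rightarrow> real \<Rightarrow> (nat \<Rightarrow> real) \<Rightarrow> (nat \<Rightarrow> real) \<Rightarrow> (nat \<Rightarrow> real) \<Rightarrow> real \<Rightarrow> nat \<Rightarrow> real" where
  "bdry_term T \<eta> \<alpha> \<beta> a b \<tau> i =
     (\<bar>b i\<bar> * (T powr (\<alpha> - \<beta> i - \<tau>) / Gamma (\<alpha> - \<beta> i))
      + \<bar>a i\<bar> * (\<eta> powr (\<alpha> - \<beta> i - \<tau>) / Gamma (\<alpha> - \<beta> i)))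
     * ((1 - \<tau>) / (\<alpha> - \<beta> i - \<tau>)) powr (1 - \<tau>)"

definition \<Delta>0 ::
  "real \<Rightarrow> real \<Rightarrow> real \<Rightarrow> (nat \<Rightarrow> real) \<Rightarrow> (nat \<Rightarrow> real) \<Rightarrow> (nat \<Rightarrow> real) \<Rightarrow> real \<Rightarrow> real" where
  "\<Delta>0 T \<eta> \<alpha> \<beta> a b \<tau> =
     T powr (\<alpha> - \<tau>) / Gamma \<alpha> * ((1 - \<tau>) / (\<alpha> - \<tau>)) powr (1 - \<tau>)
     + (\<Sum>i=0..2. rho T \<eta> \<beta> a b i * bdry_term T \<eta> \<alpha> \<beta> a b \<tau> i)"

definition \<Delta>1 ::
  "real \<Rightarrow> real \<Rightarrow> real \<Rightarrow> (nat \<Rightarrow> real) \<Rightarrow> (nat \<Rightarrow> real) \<Rightarrow> (nat \<Rightarrow> real) \<Rightarrow> real \<Rightarrow> real" where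
  "\<Delta>1 T \<eta> \<alpha> \<beta> a b \<tau> =
     T powr (\<alpha> - \<beta> 1 - \<tau>) / Gamma (\<alpha> - \<beta> 1) * ((1 - \<tau>) / (\<alpha> - \<beta> 1 - \<tau>)) powr (1 - \<tau>)
     + (\<Sum>i=1..2. rho_tilde T \<eta> \<beta> a b i * bdry_term T \<eta> \<alpha> \<beta> a b \<tau> i)"

definition \<Delta>2 ::
  "real \<Rightarrow> real \<Rightarrow> real \<Rightarrow> (nat \<Rightarrow> real) \<Rightarrow> (nat \<Rightarrow> real) \<Rightarrow> (nat \<Rightarrow> real) \<Rightarrow> real \<Rightarrow> real" where
  "\<Delta>2 T \<eta> \<alpha> \<beta> a b \<tau> =
     T powr (\<alpha> - \<beta> 2 - \<tau>) / Gamma (\<alpha> - \<beta> 2) * ((1 - \<tau>) / (\<alpha> - \<beta> 2 - \<tau>)) powr (1 - \<tau>)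
     + rho_hat T \<eta> \<beta> a b 2 * bdry_term T \<eta> \<alpha> \<beta> a b \<tau> 2"

end

theory Submission
  imports Defs
begin

text \<open>
  The nonlinear problem is a fixed point problem for triples \<open>(u, v, w)\<close> of continuous functions
  on \<open>[0,T]\<close>, where \<open>v\<close> and \<open>w\<close> stand for the Caputo derivatives of \<open>u\<close> of orders \<open>\<beta> 1\<close> and \<open>\<beta> 2\<close>.
  Treating the derivatives as independent unknowns means that only uniform limits of continuous
  functions have to be controlled; that the limit is twice differentiable and that \<open>v\<close>, \<open>w\<close> really are
  its derivatives follows from the fixed point equation itself.

  The equation rests on the linear problem. For a continuous right-hand side \<open>h\<close>, the
  semigroup law \<open>I\<^sup>\<gamma> I\<^sup>\<delta> = I\<^bsup>\<gamma>+\<delta>\<^esup>\<close> (Fubini and the Beta integral, \<open>RL_integral_semigroup\<close>) together with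
  the fundamental theorem of calculus computes the derivatives of
  \<open>u t = I\<^sup>\<alpha> h t - k0 - k1 t - k2 t\<^sup>2\<close>: the Caputo derivative of order \<open>\<beta>\<close> is \<open>I\<^bsup>\<alpha>-\<beta>\<^esup> h\<close> minus fractional
  powers of \<open>t\<close> weighted by the constants. The three boundary conditions then form a triangular
  linear system for \<open>k2\<close>, \<open>k1\<close>, \<open>k0\<close>, whose pivots (the reciprocals of \<open>\<mu>\<close> for the order
  \<open>\<beta> 2\<close> and of \<open>\<nu>\<close>, and \<open>a 0 + b 0\<close>) do not vanish; hence the linear problem has
  exactly one solution, with an explicit formula (\<open>linear_bvp_iff\<close>). The constants \<open>rho\<close>,
  \<open>rho_tilde\<close>, \<open>rho_hat\<close> bound the sensitivity of the solution and of its two derivatives to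
  the boundary data.

  If two triples are at distance \<open>N\<close>, measured by the sum of the three sup norms, their right-hand
  sides differ at \<open>t\<close> by at most \<open>lf t * N\<close>. The function \<open>lf\<close> is merely in \<open>L\<^bsup>1/\<tau>\<^esup>\<close>, but
  Hoelder's inequality against the kernel \<open>(t - s)\<^bsup>\<gamma>-1\<^esup>\<close>, whose conjugate power is integrable
  exactly because \<open>\<tau> < \<gamma>\<close>, bounds every fractional integral occurring in the solution formula (\<open>abs_RL_integral_le\<close>). Adding the three
  resulting estimates (\<open>sol_contraction_estimates\<close>) gives the left-hand side of the smallness hypothesis
  as a contraction constant, and Banach's fixed point theorem yields existence and uniqueness.
\<close>

section \<open>Riemann-Liouville integrals of continuous functions\<close>

text \<open>
  Kernel and integrand are extended by zero, so that all fractional integrals become convolutions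
  over the whole line and the limits of integration disappear from Fubini and dominated convergence.
\<close>

definition kern :: "real \<Rightarrow> real \<Rightarrow> real" where
  "kern \<gamma> x = (if 0 < x then x powr (\<gamma> - 1) else 0)"

lemma kern_nonneg [simp]: "0 \<le> kern \<gamma> x"
  by (simp add: kern_def)

lemma kern_measurable [measurable]: "kern \<gamma> \<in> borel_measurable borel"
  unfolding kern_def[abs_def] by measurable

text \<open>
  The substitution \<open>s = r + (t - r) x\<close> turns the integral into the Beta integral over \<open>[0,1]\<close>.
\<close>

lemma kern_convolution:
  assumes "\<gamma> > 0" "\<delta> > 0"
  shows "has_bochner_integral lborel (\<lambda>s. kern \<gamma> (t - s) * kern \<delta> (s - r))
           (Beta \<gamma> \<delta> * kern (\<gamma> + \<delta>) (t - r))"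
proof (cases "r < t")
  case False
  then have "(\<lambda>s. kern \<gamma> (t - s) * kern \<delta> (s - r)) = (\<lambda>s. 0)"
    by (auto simp: kern_def fun_eq_iff)
  moreover have "kern (\<gamma> + \<delta>) (t - r) = 0" using False by (simp add: kern_def)
  ultimately show ?thesis by (metis has_bochner_integral_zero mult_zero_right)
next
  case True
  define c where "c = t - r"
  have c: "c > 0" using True by (simp add: c_def)
  let ?b = "\<lambda>x. x powr (\<delta> - 1) * (1 - x) powr (\<gamma> - 1)"
  have "integral {0..1} ?b = Beta \<gamma> \<delta>"
    using has_integral_Beta_real[of \<delta> \<gamma>] assms by (simp add: Beta_commute integral_unique)
  then have "has_bochner_integral lborel (\<lambda>x. indicator {0..1} x *\<^sub>R ?b x) (Beta \<gamma> \<delta>)"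
    using integrable_Beta[of \<delta> \<gamma>] set_borel_integral_eq_integral(2)[OF integrable_Beta[of \<delta> \<gamma>]] assms
    by (simp add: has_bochner_integral_iff set_integrable_def set_lebesgue_integral_def)
  then have "has_bochner_integral lborel
      (\<lambda>x. c powr (\<gamma> + \<delta> - 2) * (indicator {0..1} x *\<^sub>R ?b x)) (c powr (\<gamma> + \<delta> - 2) * Beta \<gamma> \<delta>)"
    by (rule has_bochner_integral_mult_right)
  moreover have "c powr (\<gamma> + \<delta> - 2) * (indicator {0..1} x *\<^sub>R ?b x)
      = kern \<gamma> (t - (r + c * x)) * kern \<delta> (r + c * x - r)" for x
  proof -
    have e: "t - (r + c * x) = c * (1 - x)" by (simp add: c_def algebra_simps)
    show ?thesis
    proof (cases "0 < x \<and> x < 1")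
      case True
      have "c powr (\<gamma> + \<delta> - 2) = c powr (\<gamma> - 1) * c powr (\<delta> - 1)"
        by (simp flip: powr_add add: algebra_simps)
      then show ?thesis unfolding e using True c
        by (simp add: kern_def powr_mult zero_less_mult_iff)
    next
      case False
      then show ?thesis unfolding e using c
        by (auto simp: kern_def zero_less_mult_iff indicator_def)
    qed
  qed
  ultimately have "has_bochner_integral lborel
      (\<lambda>x. kern \<gamma> (t - (r + c * x)) * kern \<delta> (r + c * x - r)) (c powr (\<gamma> + \<delta> - 2) * Beta \<gamma> \<delta>)"
    by simp
  moreover have "c powr (\<gamma> + \<delta> - 2) * Beta \<gamma> \<delta> = (Beta \<gamma> \<delta> * kern (\<gamma> + \<delta>) (t - r)) /\<^sub>R \<bar>c\<bar>"
    using c powr_diff[of c "\<gamma> + \<delta> - 1" 1] by (simp add: kern_def c_def[symmetric] field_simps)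
  ultimately show ?thesis
    using lborel_has_bochner_integral_real_affine_iff[of c "\<lambda>s. kern \<gamma> (t - s) * kern \<delta> (s - r)" _ r] c
    by simp
qed

lemma zero_extension_measurable:
  assumes "continuous_on {0..T} (h :: real \<Rightarrow> real)"
  shows "(\<lambda>s. indicat_real {0..T} s * h s) \<in> borel_measurable borel"
  using borel_measurable_continuous_on_indicator[OF _ assms] by simp

text \<open>
  This is the convolution with the kernel of order \<open>1\<close>, which is the indicator of the positive reals.
\<close>

lemma kern_power_integral:
  assumes "\<gamma> > 0" "0 \<le> t"
  shows "has_bochner_integral lborel (\<lambda>s. indicat_real {0..t} s * (t - s) powr (\<gamma> - 1)) (t powr \<gamma> / \<gamma>)"
proof -
  have "Beta \<gamma> 1 = 1 / \<gamma>"
    using Gamma_plus1[of \<gamma>] less_imp_neq[OF Gamma_real_pos[of \<gamma>], symmetric] assms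
    by (simp add: Beta_def add.commute nonpos_Ints_def field_simps)
  moreover have "kern (\<gamma> + 1) t = t powr \<gamma>" using assms by (auto simp: kern_def)
  moreover have "AE s in lborel. s \<noteq> (0::real)" by (rule AE_lborel_singleton)
  then have "AE s in lborel. kern \<gamma> (t - s) * kern 1 (s - 0)
      = indicat_real {0..t} s * (t - s) powr (\<gamma> - 1)"
    by eventually_elim (auto simp: kern_def indicator_def)
  moreover have "has_bochner_integral lborel (\<lambda>s. kern \<gamma> (t - s) * kern 1 (s - 0))
      (Beta \<gamma> 1 * kern (\<gamma> + 1) (t - 0))"
    using assms by (intro kern_convolution) auto
  ultimately show ?thesis
    by (subst (asm) has_bochner_integral_cong_AE[where g="\<lambda>s. indicat_real {0..t} s * (t - s) powr (\<gamma> - 1)"]) auto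
qed

lemma kern_integrable:
  assumes h: "continuous_on {0..T} h" and g: "\<gamma> > 0" and t: "0 \<le> t"
  shows "integrable lborel (\<lambda>s. kern \<gamma> (t - s) * (indicat_real {0..T} s * h s))"
proof -
  note zero_extension_measurable[OF h, measurable]
  obtain B where B: "\<And>s. s \<in> {0..T} \<Longrightarrow> \<bar>h s\<bar> \<le> B"
    using compact_imp_bounded[OF compact_continuous_image[OF h compact_Icc]]
    by (fastforce simp: bounded_iff)
  have "integrable lborel (\<lambda>s. B * (indicat_real {0..t} s * (t - s) powr (\<gamma> - 1)))"
    using kern_power_integral[OF g t] by (auto simp: has_bochner_integral_iff)
  then show ?thesis
  proof (rule Bochner_Integration.integrable_bound)
    show "AE s in lborel. norm (kern \<gamma> (t - s) * (indicat_real {0..T} s * h s))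
        \<le> norm (B * (indicat_real {0..t} s * (t - s) powr (\<gamma> - 1)))"
    proof (rule AE_I2)
      fix s
      show "norm (kern \<gamma> (t - s) * (indicat_real {0..T} s * h s))
          \<le> norm (B * (indicat_real {0..t} s * (t - s) powr (\<gamma> - 1)))"
      proof (cases "s \<in> {0..T} \<and> s < t")
        case True
        then have "\<bar>h s\<bar> * (t - s) powr (\<gamma> - 1) \<le> \<bar>B\<bar> * (t - s) powr (\<gamma> - 1)"
          using B[of s] by (intro mult_right_mono) auto
        then show ?thesis using True by (auto simp: kern_def abs_mult mult.commute)
      qed (auto simp: kern_def)
    qed
  qed measurable
qed

lemma RL_integrand_kern:
  fixes t T \<gamma> s :: real
  assumes "t \<in> {0..T}"
  shows "indicat_real {0..t} s * ((t - s) powr (\<gamma> - 1) * h s)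
    = kern \<gamma> (t - s) * (indicat_real {0..T} s * h s)"
  using assms by (auto simp: kern_def indicator_def)

lemma RL_integrand_integrable:
  fixes h :: "real \<Rightarrow> real" and t T \<gamma> :: real
  assumes h: "continuous_on {0..T} h" and t: "t \<in> {0..T}" and g: "\<gamma> > 0"
  shows "set_integrable lebesgue {0..t} (\<lambda>s. (t - s) powr (\<gamma> - 1) * h s)"
proof -
  have "integrable lborel (\<lambda>s. kern \<gamma> (t - s) * (indicat_real {0..T} s * h s))"
    using kern_integrable[OF h g] t by auto
  then show ?thesis
    unfolding set_integrable_def real_scaleR_def RL_integrand_kern[OF t]
    by (subst integrable_completion) auto
qed

text \<open>
  The passage to \<open>lborel\<close> is what makes the product measure results applicable.
\<close>

lemma RL_integral_kern:
  assumes h: "continuous_on {0..T} h" and t: "t \<in> {0..T}"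
  shows "RL_integral \<gamma> h t = (\<integral>s. kern \<gamma> (t - s) * (indicat_real {0..T} s * h s) \<partial>lborel) / Gamma \<gamma>"
proof -
  note zero_extension_measurable[OF h, measurable]
  show ?thesis
    unfolding RL_integral_def set_lebesgue_integral_def real_scaleR_def RL_integrand_kern[OF t]
    by (subst integral_completion) (auto)
qed

lemma RL_integral_cong:
  assumes "\<And>s. s \<in> {0..t} \<Longrightarrow> h s = k s"
  shows "RL_integral \<gamma> h t = RL_integral \<gamma> k t"
  unfolding RL_integral_def
  by (intro arg_cong[where f="(*) _"] set_lebesgue_integral_cong) (auto simp: assms)

lemma RL_integral_add:
  assumes "continuous_on {0..T} h" "continuous_on {0..T} k" "t \<in> {0..T}" "\<gamma> > 0"
  shows "RL_integral \<gamma> (\<lambda>s. h s + k s) t = RL_integral \<gamma> h t + RL_integral \<gamma> k t"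
  using set_integral_add[OF RL_integrand_integrable[OF assms(1,3,4)] RL_integrand_integrable[OF assms(2,3,4)]]
  by (simp add: RL_integral_def distrib_left add_divide_distrib)

lemma RL_integral_diff:
  assumes "continuous_on {0..T} h" "continuous_on {0..T} k" "t \<in> {0..T}" "\<gamma> > 0"
  shows "RL_integral \<gamma> (\<lambda>s. h s - k s) t = RL_integral \<gamma> h t - RL_integral \<gamma> k t"
  using set_integral_diff[OF RL_integrand_integrable[OF assms(1,3,4)] RL_integrand_integrable[OF assms(2,3,4)]]
  by (simp add: RL_integral_def right_diff_distrib diff_divide_distrib)

lemma RL_integral_cmult: "RL_integral \<gamma> (\<lambda>s. c * h s) t = c * RL_integral \<gamma> h t"
proof -
  have "(\<lambda>s. (t - s) powr (\<gamma> - 1) * (c * h s)) = (\<lambda>s. c * ((t - s) powr (\<gamma> - 1) * h s))"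
    by (simp add: ac_simps)
  then show ?thesis by (simp add: RL_integral_def)
qed

lemma RL_integral_zero [simp]: "RL_integral \<gamma> h 0 = 0"
proof -
  have "(LINT s:{0..0}|lebesgue. (0 - s) powr (\<gamma> - 1) * h s) = (LINT s:{0..0::real}|lebesgue. 0)"
    by (intro set_lebesgue_integral_cong) auto
  then show ?thesis by (simp add: RL_integral_def set_lebesgue_integral_def)
qed

lemma RL_integral_const:
  assumes "\<gamma> > 0" "0 \<le> t"
  shows "RL_integral \<gamma> (\<lambda>s. c) t = c * (t powr \<gamma> / Gamma (\<gamma> + 1))"
proof -
  have "RL_integral \<gamma> (\<lambda>s. 1) t = (\<integral>s. kern \<gamma> (t - s) * (indicat_real {0..t} s * 1) \<partial>lborel) / Gamma \<gamma>"
    using assms by (intro RL_integral_kern) auto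
  also have "(\<lambda>s. kern \<gamma> (t - s) * (indicat_real {0..t} s * 1)) = (\<lambda>s. indicat_real {0..t} s * (t - s) powr (\<gamma> - 1))"
    by (auto simp: kern_def fun_eq_iff indicator_def)
  finally have "RL_integral \<gamma> (\<lambda>s. 1) t = t powr \<gamma> / Gamma (\<gamma> + 1)"
    using has_bochner_integral_integral_eq[OF kern_power_integral[OF assms]] assms
    by (simp add: Gamma_plus1 nonpos_Ints_def)
  then show ?thesis using RL_integral_cmult[of \<gamma> c "\<lambda>s. 1" t] by simp
qed

lemma zero_extension_isCont:
  assumes h: "continuous_on {0..T} (h :: real \<Rightarrow> real)" and "x \<noteq> 0" "x \<noteq> T"
  shows "isCont (\<lambda>s. indicat_real {0..T} s * h s) x"
proof -
  consider "x \<in> {0<..<T}" | "x \<in> - {0..T}" using assms by force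
  then show ?thesis
  proof cases
    case 1
    have "continuous_on {0<..<T} (\<lambda>s. indicat_real {0..T} s * h s) \<longleftrightarrow> continuous_on {0<..<T} h"
      by (intro continuous_on_cong) auto
    then have "continuous_on {0<..<T} (\<lambda>s. indicat_real {0..T} s * h s)"
      using continuous_on_subset[OF h greaterThanLessThan_subseteq_atLeastAtMost_iff[THEN iffD2]] by simp
    then show ?thesis using 1 by (auto simp: continuous_on_eq_continuous_at)
  next
    case 2
    have "continuous_on (- {0..T}) (\<lambda>s. indicat_real {0..T} s * h s) \<longleftrightarrow> continuous_on (- {0..T}) (\<lambda>s. 0::real)"
      by (intro continuous_on_cong) auto
    then show ?thesis using 2 by (subst (asm) continuous_on_eq_continuous_at) auto
  qed
qed

text \<open>
  After the reflection \<open>s \<mapsto> t - s\<close> the singular kernel no longer depends on \<open>t\<close>, and dominated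
  convergence applies: the zero extension of \<open>h\<close> is continuous except at the two end points.
\<close>

lemma continuous_on_RL_integral:
  assumes h: "continuous_on {0..T} h" and g: "\<gamma> > 0"
  shows "continuous_on {0..T} (RL_integral \<gamma> h)"
proof (cases "0 \<le> T")
  case False then show ?thesis by simp
next
  case T: True
  note zero_extension_measurable[OF h, measurable]
  define H where "H = (\<lambda>s. indicat_real {0..T} s * h s)"
  have H_meas [measurable]: "H \<in> borel_measurable borel" by (simp add: H_def)
  obtain B where B0: "\<And>s. s \<in> {0..T} \<Longrightarrow> \<bar>h s\<bar> \<le> B"
    using compact_imp_bounded[OF compact_continuous_image[OF h compact_Icc]]
    by (fastforce simp: bounded_iff)
  have Bnn: "0 \<le> B" using B0[of 0] T by auto
  have B: "\<bar>H s\<bar> \<le> B" for s using B0 Bnn by (auto simp: H_def indicator_def)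
  define F where "F t = (\<integral>s. kern \<gamma> s * H (t - s) \<partial>lborel)" for t
  have reflect: "(\<integral>s. kern \<gamma> (t - s) * H s \<partial>lborel) = F t" for t
    unfolding F_def by (subst lborel_integral_real_affine[where c="-1" and t=t]) auto
  \<comment> \<open>The function \<open>B * s powr (\<gamma> - 1)\<close> on \<open>[0,T]\<close>, written as a reflection so that its
      integrability is an instance of the power integral.\<close>
  define w where "w s = B * (indicat_real {0..T} (T - s) * (T - (T - s)) powr (\<gamma> - 1))" for s
  have wint: "integrable lborel w"
    unfolding w_def using kern_power_integral[OF g T]
    by (intro integrable_mult_right lborel_integrable_real_affine[where c="-1" and t=T, simplified])
       (auto simp: has_bochner_integral_iff)
  have "continuous_on {0..T} F"
    unfolding continuous_on_sequentially comp_def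
  proof (intro allI impI ballI)
    fix x and t assume x: "t \<in> {0..T}" "(\<forall>n. x n \<in> {0..T}) \<and> x \<longlonglongrightarrow> t"
    show "(\<lambda>n. F (x n)) \<longlonglongrightarrow> F t"
      unfolding F_def
    proof (rule integral_dominated_convergence[where w=w])
      have "AE s in lborel. s \<noteq> t" "AE s in lborel. s \<noteq> t - T" by (rule AE_lborel_singleton)+
      then show "AE s in lborel. (\<lambda>n. kern \<gamma> s * H (x n - s)) \<longlonglongrightarrow> kern \<gamma> s * H (t - s)"
      proof eventually_elim
        case (elim s)
        have "isCont H (t - s)"
          unfolding H_def using elim by (intro zero_extension_isCont h) auto
        moreover have "(\<lambda>n. x n - s) \<longlonglongrightarrow> t - s" using x by (intro tendsto_intros) auto
        ultimately have "(\<lambda>n. H (x n - s)) \<longlonglongrightarrow> H (t - s)" by (rule isCont_tendsto_compose)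
        then show ?case by (intro tendsto_intros)
      qed
      show "AE s in lborel. norm (kern \<gamma> s * H (x n - s)) \<le> w s" for n
      proof (rule AE_I2)
        fix s
        show "norm (kern \<gamma> s * H (x n - s)) \<le> w s"
        proof (cases "0 < s \<and> s \<le> T")
          case True
          then have "s powr (\<gamma> - 1) * \<bar>H (x n - s)\<bar> \<le> s powr (\<gamma> - 1) * B"
            by (intro mult_left_mono B) auto
          then show ?thesis using True by (simp add: kern_def w_def abs_mult mult.commute)
        next
          case False
          have "x n \<le> T" using x(2) by auto
          then have "kern \<gamma> s * H (x n - s) = 0" using False by (auto simp: kern_def H_def)
          moreover have "0 \<le> w s" using Bnn by (simp add: w_def)
          ultimately show ?thesis by (simp only: norm_zero)
        qed
      qed
    qed (use wint in measurable)
  qed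
  then have "continuous_on {0..T} (\<lambda>t. F t / Gamma \<gamma>)"
    using g by (intro continuous_intros) (auto simp: Gamma_eq_zero_iff nonpos_Ints_def)
  then show ?thesis
    by (rule continuous_on_eq)
       (simp add: RL_integral_kern[OF h] reflect[symmetric] H_def)
qed

text \<open>
  Interchanging the two integrations leaves, for fixed \<open>r\<close>, the convolution of the kernels of orders
  \<open>\<gamma>\<close> and \<open>\<delta>\<close>; its Beta factor cancels against the normalizing Gamma factors.
\<close>

lemma RL_integral_semigroup:
  assumes h: "continuous_on {0..T} h" and pos: "\<gamma> > 0" "\<delta> > 0" and t: "t \<in> {0..T}"
  shows "RL_integral \<gamma> (RL_integral \<delta> h) t = RL_integral (\<gamma> + \<delta>) h t"
proof -
  define H where "H = (\<lambda>s. indicat_real {0..T} s * h s)"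
  have H_meas [measurable]: "H \<in> borel_measurable borel"
    using zero_extension_measurable[OF h] by (simp add: H_def)
  have Hc: "continuous_on {0..T} (\<lambda>s. \<bar>h s\<bar>)" using h by (intro continuous_intros)
  let ?F = "\<lambda>r s. kern \<gamma> (t - s) * kern \<delta> (s - r) * H r"
  have inner: "has_bochner_integral lborel (\<lambda>s. kern \<gamma> (t - s) * kern \<delta> (s - r) * c)
      (Beta \<gamma> \<delta> * kern (\<gamma> + \<delta>) (t - r) * c)" for r c
    by (intro has_bochner_integral_mult_left kern_convolution pos)
  have F: "integrable (lborel \<Otimes>\<^sub>M lborel) (case_prod ?F)"
  proof (rule lborel_pair.Fubini_integrable)
    have "(\<integral>s. norm (case_prod ?F (r, s)) \<partial>lborel)
        = Beta \<gamma> \<delta> * (kern (\<gamma> + \<delta>) (t - r) * (indicat_real {0..T} r * \<bar>h r\<bar>))" for r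
      using has_bochner_integral_integral_eq[OF inner[of r "\<bar>H r\<bar>"]]
      by (simp add: abs_mult H_def mult.assoc)
    then show "integrable lborel (\<lambda>r. \<integral>s. norm (case_prod ?F (r, s)) \<partial>lborel)"
      using kern_integrable[OF Hc, of "\<gamma> + \<delta>" t] pos t by simp
    show "AE r in lborel. integrable lborel (\<lambda>s. case_prod ?F (r, s))"
      using inner by (auto simp: has_bochner_integral_iff)
  qed measurable
  have Gne: "Gamma \<gamma> \<noteq> 0" "Gamma \<delta> \<noteq> 0" "Gamma (\<gamma> + \<delta>) \<noteq> 0"
    using pos by (simp_all add: less_imp_neq[OF Gamma_real_pos, symmetric])
  have inner_s: "(\<integral>r. ?F r s \<partial>lborel)
      = Gamma \<delta> * (kern \<gamma> (t - s) * (indicat_real {0..T} s * RL_integral \<delta> h s))" for s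
  proof (cases "s \<in> {0..T}")
    case True
    have "(\<integral>r. ?F r s \<partial>lborel) = kern \<gamma> (t - s) * (\<integral>r. kern \<delta> (s - r) * H r \<partial>lborel)"
      by (simp add: mult.assoc)
    then show ?thesis using True Gne by (simp add: RL_integral_kern[OF h True] H_def)
  next
    case False
    have "(\<lambda>r. ?F r s) = (\<lambda>r. 0)"
      using False t by (auto simp: kern_def H_def indicator_def)
    then have "(\<integral>r. ?F r s \<partial>lborel) = 0" by (simp only: integral_zero)
    then show ?thesis using False by simp
  qed
  have "Gamma \<delta> * (\<integral>s. kern \<gamma> (t - s) * (indicat_real {0..T} s * RL_integral \<delta> h s) \<partial>lborel)
      = (\<integral>s. (\<integral>r. ?F r s \<partial>lborel) \<partial>lborel)"
    unfolding inner_s by simp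
  also have "\<dots> = (\<integral>r. (\<integral>s. ?F r s \<partial>lborel) \<partial>lborel)"
    by (rule lborel_pair.Fubini_integral[OF F])
  also have "\<dots> = (\<integral>r. Beta \<gamma> \<delta> * (kern (\<gamma> + \<delta>) (t - r) * H r) \<partial>lborel)"
    using has_bochner_integral_integral_eq[OF inner] by (simp add: mult.assoc)
  also have "\<dots> = Beta \<gamma> \<delta> * (\<integral>r. kern (\<gamma> + \<delta>) (t - r) * H r \<partial>lborel)" by simp
  also have "\<dots> = Gamma \<gamma> * Gamma \<delta> * RL_integral (\<gamma> + \<delta>) h t"
    using Gne by (simp add: RL_integral_kern[OF h t] H_def Beta_def)
  finally show ?thesis
    using Gne by (simp add: RL_integral_kern[OF continuous_on_RL_integral[OF h] t] pos field_simps)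
qed

lemma RL_integral_1_has_derivative:
  assumes h: "continuous_on {0..T} h" and t: "t \<in> {0..T}"
  shows "(RL_integral 1 h has_vector_derivative h t) (at t within {0..T})"
proof -
  have "RL_integral 1 h x = integral {0..x} h" if x: "x \<in> {0..T}" for x
  proof -
    have "AE s in lebesgue. s \<noteq> x" by (intro AE_completion AE_lborel_singleton)
    then have "RL_integral 1 h x = (LINT s:{0..x}|lebesgue. h s)"
      unfolding RL_integral_def set_lebesgue_integral_def
      using RL_integrand_integrable[OF h x, of 1] absolutely_integrable_continuous_real[OF continuous_on_subset[OF h], of 0 x] x
      by (simp add: Gamma_1, intro integral_cong_AE)
         (auto simp: set_integrable_def elim!: eventually_mono)
    also have "\<dots> = integral {0..x} h"
      using x by (intro set_lebesgue_integral_eq_integral absolutely_integrable_continuous_real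
          continuous_on_subset[OF h]) auto
    finally show ?thesis .
  qed
  then show ?thesis
    using integral_has_vector_derivative[OF h t] t
    by (metis (no_types, lifting) has_vector_derivative_transform)
qed

text \<open>
  By the semigroup law the integral of order \<open>\<gamma> + 1\<close> is the ordinary primitive of the one of order \<open>\<gamma>\<close>.
\<close>

lemma RL_integral_has_derivative:
  assumes h: "continuous_on {0..T} h" and g: "\<gamma> > 0" and t: "t \<in> {0..T}"
  shows "(RL_integral (\<gamma> + 1) h has_vector_derivative RL_integral \<gamma> h t) (at t within {0..T})"
  using RL_integral_1_has_derivative[OF continuous_on_RL_integral[OF h g] t]
  by (rule has_vector_derivative_transform[rotated 2])
     (use t g in \<open>auto simp: RL_integral_semigroup[OF h] add.commute\<close>)

section \<open>Caputo derivatives of integrated solutions\<close>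

text \<open>
  The fractional integral of order \<open>\<gamma>\<close> of the constant \<open>1\<close>, extended to order \<open>0\<close>. That order needs its
  own clause since \<open>0 powr 0 = 0\<close>, which would make the function jump at \<open>0\<close>; it occurs when a
  Caputo derivative has integer order.
\<close>

definition fpow :: "real \<Rightarrow> real \<Rightarrow> real" where
  "fpow \<gamma> t = (if \<gamma> = 0 then 1 else t powr \<gamma> / Gamma (\<gamma> + 1))"

lemma fpow_pos_eq:
  assumes "0 < t" shows "fpow \<gamma> t = t powr \<gamma> / Gamma (\<gamma> + 1)"
  using assms by (simp add: fpow_def)

lemma fpow_le:
  assumes "0 \<le> t" "t \<le> T" "0 < T" "0 \<le> \<gamma>"
  shows "0 \<le> fpow \<gamma> t" "fpow \<gamma> t \<le> T powr \<gamma> / Gamma (\<gamma> + 1)"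
  using assms powr_mono2[of \<gamma> t T] by (auto simp: fpow_def intro!: divide_right_mono Gamma_real_nonneg)

lemma continuous_on_fpow:
  assumes "0 \<le> \<gamma>" shows "continuous_on {0..T} (fpow \<gamma>)"
proof (cases "\<gamma> = 0")
  case True then show ?thesis by (simp add: fpow_def[abs_def])
next
  case False
  have "continuous_on {0..T} (\<lambda>t. t powr \<gamma> / Gamma (\<gamma> + 1))"
    using assms False less_imp_neq[OF Gamma_real_pos[of "\<gamma> + 1"]]
    by (intro continuous_intros continuous_on_powr') auto
  then show ?thesis using False by (simp add: fpow_def[abs_def])
qed

text \<open>
  The identity function is the integral of order \<open>1\<close> of the constant \<open>1\<close>, so the semigroup law
  reduces it to a constant.
\<close>

lemma RL_integral_affine:
  assumes "\<gamma> > 0" "0 \<le> t"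
  shows "RL_integral \<gamma> (\<lambda>s. c + d * s) t = c * fpow \<gamma> t + d * fpow (\<gamma> + 1) t"
proof -
  have t: "t \<in> {0..t}" using assms by auto
  have "RL_integral \<gamma> (\<lambda>s. s) t = RL_integral \<gamma> (RL_integral 1 (\<lambda>s. 1)) t"
    by (intro RL_integral_cong) (simp add: RL_integral_const Gamma_numeral)
  also have "\<dots> = fpow (\<gamma> + 1) t"
    using RL_integral_semigroup[of t "\<lambda>s. 1" \<gamma> 1 t] RL_integral_const[of "\<gamma> + 1" t 1] assms
    by (simp add: fpow_def)
  finally have "RL_integral \<gamma> (\<lambda>s. s) t = fpow (\<gamma> + 1) t" .
  then show ?thesis
    using RL_integral_add[OF _ _ t, of "\<lambda>s. c" "\<lambda>s. d * s" \<gamma>] RL_integral_const[of \<gamma> t c] assms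
      RL_integral_cmult[of \<gamma> d "\<lambda>s. s" t]
    by (simp add: fpow_def continuous_intros)
qed

lemma nderiv_on_0 [simp]: "nderiv_on T 0 u = u"
  by (simp add: nderiv_on_def)

lemma nderiv_on_Suc:
  "nderiv_on T (Suc n) u t = vector_derivative (nderiv_on T n u) (at t within {0..T})"
  by (simp add: nderiv_on_def)

text \<open>
  Derivatives within \<open>{0..T}\<close> only see the values on that interval, so a formula for the previous
  derivative need only hold there.
\<close>

lemma nderiv_on_SucI:
  assumes "0 < T" and eq: "\<And>t. t \<in> {0..T} \<Longrightarrow> nderiv_on T n u t = p t"
    and der: "\<And>t. t \<in> {0..T} \<Longrightarrow> (p has_vector_derivative q t) (at t within {0..T})"
    and t: "t \<in> {0..T}"
  shows "(nderiv_on T n u has_vector_derivative q t) (at t within {0..T})"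
    and "nderiv_on T (Suc n) u t = q t"
proof -
  show d: "(nderiv_on T n u has_vector_derivative q t) (at t within {0..T})"
    using der[OF t] by (rule has_vector_derivative_transform[OF t, rotated]) (simp add: eq)
  show "nderiv_on T (Suc n) u t = q t"
    unfolding nderiv_on_Suc using assms(1) t d
    by (intro vector_derivative_within_closed_interval) auto
qed

lemma caputo_1:
  assumes "0 < \<beta>" "\<beta> \<le> 1"
  shows "caputo T \<beta> u t = (if \<beta> = 1 then nderiv_on T 1 u t else RL_integral (1 - \<beta>) (nderiv_on T 1 u) t)"
proof -
  have "\<lceil>\<beta>\<rceil> = 1" using assms by (simp add: ceiling_eq_iff)
  then show ?thesis by (simp add: caputo_def RL_integral_def)
qed

lemma caputo_2:
  assumes "1 < \<beta>" "\<beta> \<le> 2"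
  shows "caputo T \<beta> u t = (if \<beta> = 2 then nderiv_on T 2 u t else RL_integral (2 - \<beta>) (nderiv_on T 2 u) t)"
proof -
  have "\<lceil>\<beta>\<rceil> = 2" using assms by (simp add: ceiling_eq_iff)
  then show ?thesis by (simp add: caputo_def RL_integral_def)
qed

lemma continuous_on_nderiv:
  assumes "cont_diff_on T m u" "k \<le> m"
  shows "continuous_on {0..T} (nderiv_on T k u)"
proof (cases "k = m")
  case False
  then show ?thesis using assms
    by (auto simp: cont_diff_on_def continuous_on_eq_continuous_within
        intro!: differentiable_imp_continuous_within)
qed (use assms in \<open>simp add: cont_diff_on_def\<close>)

lemma continuous_on_caputo:
  assumes u: "cont_diff_on T 2 u" and "0 < \<beta>" "\<beta> \<le> 2"
  shows "continuous_on {0..T} (caputo T \<beta> u)"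
proof (cases "\<beta> \<le> 1")
  case True
  then have "caputo T \<beta> u = (if \<beta> = 1 then nderiv_on T 1 u else RL_integral (1 - \<beta>) (nderiv_on T 1 u))"
    using assms by (intro ext) (simp add: caputo_1)
  then show ?thesis using True continuous_on_nderiv[OF u, of 1]
    by (auto intro: continuous_on_RL_integral)
next
  case False
  then have "caputo T \<beta> u = (if \<beta> = 2 then nderiv_on T 2 u else RL_integral (2 - \<beta>) (nderiv_on T 2 u))"
    using assms by (intro ext) (simp add: caputo_2)
  then show ?thesis using assms continuous_on_nderiv[OF u, of 2]
    by (auto intro: continuous_on_RL_integral)
qed

text \<open>
  In this block \<open>u\<close> is a solution of the equation of order \<open>\<alpha>\<close> with right-hand side \<open>h\<close>, with
  integration constants \<open>k0\<close>, \<open>k1\<close>, \<open>k2\<close>.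
\<close>

context
  fixes T \<alpha> k0 k1 k2 :: real and h u :: "real \<Rightarrow> real"
  assumes T: "0 < T" and \<alpha>: "2 < \<alpha>" and h: "continuous_on {0..T} h"
    and u: "\<And>t. t \<in> {0..T} \<Longrightarrow> u t = RL_integral \<alpha> h t - k0 - k1 * t - k2 * t\<^sup>2"
begin

lemma RL_integral_has_derivative_pred:
  assumes "\<gamma> > 1" "t \<in> {0..T}"
  shows "(RL_integral \<gamma> h has_vector_derivative RL_integral (\<gamma> - 1) h t) (at t within {0..T})"
  using RL_integral_has_derivative[OF h, of "\<gamma> - 1" t] assms by simp

lemma solution_has_derivative:
  assumes "t \<in> {0..T}"
  shows "(u has_vector_derivative RL_integral (\<alpha> - 1) h t - k1 - 2 * k2 * t) (at t within {0..T})"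
    and "nderiv_on T 1 u t = RL_integral (\<alpha> - 1) h t - k1 - 2 * k2 * t"
proof -
  have "((\<lambda>t. RL_integral \<alpha> h t - k0 - k1 * t - k2 * t\<^sup>2) has_vector_derivative
      RL_integral (\<alpha> - 1) h s - k1 - 2 * k2 * s) (at s within {0..T})" if "s \<in> {0..T}" for s
    using that \<alpha>
    by (auto intro!: derivative_eq_intros RL_integral_has_derivative_pred
        simp: has_real_derivative_iff_has_vector_derivative[symmetric]
          RL_integral_has_derivative_pred[unfolded has_real_derivative_iff_has_vector_derivative[symmetric]])
  from nderiv_on_SucI[where n=0 and u=u, unfolded nderiv_on_0, OF T u this assms]
  show "(u has_vector_derivative RL_integral (\<alpha> - 1) h t - k1 - 2 * k2 * t) (at t within {0..T})"
    and "nderiv_on T 1 u t = RL_integral (\<alpha> - 1) h t - k1 - 2 * k2 * t"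
    by simp_all
qed

lemma solution_has_derivative2:
  assumes "t \<in> {0..T}"
  shows "(nderiv_on T 1 u has_vector_derivative RL_integral (\<alpha> - 2) h t - 2 * k2) (at t within {0..T})"
    and "nderiv_on T 2 u t = RL_integral (\<alpha> - 2) h t - 2 * k2"
proof -
  have "((\<lambda>t. RL_integral (\<alpha> - 1) h t - k1 - 2 * k2 * t) has_vector_derivative
      RL_integral (\<alpha> - 2) h s - 2 * k2) (at s within {0..T})" if "s \<in> {0..T}" for s
    using that \<alpha> RL_integral_has_derivative_pred[of "\<alpha> - 1" s]
    by (auto intro!: derivative_eq_intros
        simp: has_real_derivative_iff_has_vector_derivative[symmetric])
  from nderiv_on_SucI[OF T solution_has_derivative(2) this assms]
  show "(nderiv_on T 1 u has_vector_derivative RL_integral (\<alpha> - 2) h t - 2 * k2) (at t within {0..T})"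
    and "nderiv_on T 2 u t = RL_integral (\<alpha> - 2) h t - 2 * k2"
    by (simp_all add: numeral_2_eq_2)
qed

lemma solution_cont_diff: "cont_diff_on T 2 u"
proof -
  have "continuous_on {0..T} (\<lambda>t. RL_integral (\<alpha> - 2) h t - 2 * k2)"
    using \<alpha> by (intro continuous_intros continuous_on_RL_integral h) auto
  then have "continuous_on {0..T} (nderiv_on T 2 u)"
    by (rule continuous_on_eq) (simp add: solution_has_derivative2)
  moreover have "nderiv_on T k u differentiable (at t within {0..T})" if "k < 2" "t \<in> {0..T}" for k t
  proof -
    have "k = 0 \<or> k = 1" using that by auto
    then show ?thesis
      using differentiableI_vector[OF solution_has_derivative(1)[OF that(2)]]
        differentiableI_vector[OF solution_has_derivative2(1)[OF that(2)]] by auto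
  qed
  ultimately show ?thesis by (simp add: cont_diff_on_def)
qed

text \<open>
  The first derivative of \<open>u\<close> contains the integral of \<open>h\<close> of order \<open>\<alpha> - 1\<close>; a further integration of
  order \<open>1 - \<beta>\<close> gives order \<open>\<alpha> - \<beta>\<close> by the semigroup law.
\<close>

lemma caputo_solution_1:
  assumes \<beta>: "0 < \<beta>" "\<beta> \<le> 1" and t: "t \<in> {0..T}"
  shows "caputo T \<beta> u t
    = RL_integral (\<alpha> - \<beta>) h t - k1 * fpow (1 - \<beta>) t - 2 * k2 * fpow (2 - \<beta>) t"
proof (cases "\<beta> = 1")
  case True
  then show ?thesis using t solution_has_derivative(2)[OF t]
    by (simp add: caputo_1 fpow_def Gamma_numeral)
next
  case False
  have "RL_integral (1 - \<beta>) (nderiv_on T 1 u) t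
      = RL_integral (1 - \<beta>) (\<lambda>s. RL_integral (\<alpha> - 1) h s - (k1 + 2 * k2 * s)) t"
    using t by (intro RL_integral_cong, subst solution_has_derivative(2)) auto
  also have "\<dots> = RL_integral (1 - \<beta>) (RL_integral (\<alpha> - 1) h) t - RL_integral (1 - \<beta>) (\<lambda>s. k1 + 2 * k2 * s) t"
    using t \<alpha> \<beta> False by (intro RL_integral_diff[where T=T] continuous_on_RL_integral h continuous_intros) auto
  also have "\<dots> = RL_integral (\<alpha> - \<beta>) h t - (k1 * fpow (1 - \<beta>) t + 2 * k2 * fpow (2 - \<beta>) t)"
    using t \<alpha> \<beta> False RL_integral_affine[of "1 - \<beta>" t k1 "2 * k2"]
    by (simp add: RL_integral_semigroup[OF h])
  finally show ?thesis using False \<beta> by (simp add: caputo_1)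
qed

lemma caputo_solution_2:
  assumes \<beta>: "1 < \<beta>" "\<beta> \<le> 2" and t: "t \<in> {0..T}"
  shows "caputo T \<beta> u t = RL_integral (\<alpha> - \<beta>) h t - 2 * k2 * fpow (2 - \<beta>) t"
proof (cases "\<beta> = 2")
  case True
  then show ?thesis using solution_has_derivative2(2)[OF t]
    by (simp add: caputo_2 fpow_def)
next
  case False
  have "RL_integral (2 - \<beta>) (nderiv_on T 2 u) t
      = RL_integral (2 - \<beta>) (\<lambda>s. RL_integral (\<alpha> - 2) h s - 2 * k2) t"
    using t by (intro RL_integral_cong solution_has_derivative2(2)) auto
  also have "\<dots> = RL_integral (2 - \<beta>) (RL_integral (\<alpha> - 2) h) t - RL_integral (2 - \<beta>) (\<lambda>s. 2 * k2) t"
    using t \<alpha> \<beta> False by (intro RL_integral_diff[where T=T] continuous_on_RL_integral h continuous_intros) auto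
  also have "\<dots> = RL_integral (\<alpha> - \<beta>) h t - 2 * k2 * fpow (2 - \<beta>) t"
    using t \<alpha> \<beta> False RL_integral_const[of "2 - \<beta>" t "2 * k2"]
    by (simp add: RL_integral_semigroup[OF h] fpow_def)
  finally show ?thesis using False \<beta> by (simp add: caputo_2)
qed

end

section \<open>Lipschitz bounds in Lebesgue norms\<close>

text \<open>
  Hoelder's inequality for the conjugate exponents \<open>1 / (1 - \<tau>)\<close> and \<open>1 / \<tau>\<close>, stated for the powers that
  are integrable, which keeps the exponents out of the integrals. It is Young's inequality applied to
  both functions after they are normalized to integral \<open>1\<close>.
\<close>

lemma Holder_integral:
  fixes F G :: "'a \<Rightarrow> real"
  assumes F: "integrable M F" and G: "integrable M G"
    and nn: "\<And>x. 0 \<le> F x" "\<And>x. 0 \<le> G x" and \<tau>: "0 < \<tau>" "\<tau> < 1"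
  shows "integrable M (\<lambda>x. F x powr (1 - \<tau>) * G x powr \<tau>)"
    and "(\<integral>x. F x powr (1 - \<tau>) * G x powr \<tau> \<partial>M) \<le> (\<integral>x. F x \<partial>M) powr (1 - \<tau>) * (\<integral>x. G x \<partial>M) powr \<tau>"
proof -
  have [measurable]: "F \<in> borel_measurable M" "G \<in> borel_measurable M" using F G by auto
  have young: "x powr (1 - \<tau>) * y powr \<tau> \<le> (1 - \<tau>) * x + \<tau> * y" if "0 \<le> x" "0 \<le> y" for x y :: real
    using Youngs_inequality_0[of "1 - \<tau>" \<tau> x y] that \<tau> by (cases "x = 0 \<or> y = 0") auto
  show int: "integrable M (\<lambda>x. F x powr (1 - \<tau>) * G x powr \<tau>)"
    by (rule Bochner_Integration.integrable_bound[where f="\<lambda>x. (1 - \<tau>) * F x + \<tau> * G x"])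
      (use F G nn \<tau> young in \<open>auto intro!: order_trans[OF young]\<close>)
  define A B where "A = (\<integral>x. F x \<partial>M)" and "B = (\<integral>x. G x \<partial>M)"
  have AB: "0 \<le> A" "0 \<le> B" unfolding A_def B_def using nn by simp_all
  show "(\<integral>x. F x powr (1 - \<tau>) * G x powr \<tau> \<partial>M) \<le> A powr (1 - \<tau>) * B powr \<tau>"
  proof (cases "A = 0 \<or> B = 0")
    case True
    then have "AE x in M. F x = 0 \<or> G x = 0"
      using integral_nonneg_eq_0_iff_AE[OF F] integral_nonneg_eq_0_iff_AE[OF G] nn
      by (auto simp: A_def B_def elim: eventually_mono)
    then have "AE x in M. F x powr (1 - \<tau>) * G x powr \<tau> = 0" by (auto elim: eventually_mono)
    then have "(\<integral>x. F x powr (1 - \<tau>) * G x powr \<tau> \<partial>M) = 0"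
      by (rule integral_eq_zero_AE)
    then show ?thesis by simp
  next
    case False
    then have pos: "0 < A" "0 < B" using AB by auto
    define C where "C = A powr (1 - \<tau>) * B powr \<tau>"
    have "(\<integral>x. F x powr (1 - \<tau>) * G x powr \<tau> \<partial>M)
        \<le> (\<integral>x. C * ((1 - \<tau>) * (F x / A) + \<tau> * (G x / B)) \<partial>M)"
    proof (rule integral_mono)
      fix x
      have "F x powr (1 - \<tau>) * G x powr \<tau> = C * ((F x / A) powr (1 - \<tau>) * (G x / B) powr \<tau>)"
        using pos nn by (simp add: powr_divide C_def)
      also have "\<dots> \<le> C * ((1 - \<tau>) * (F x / A) + \<tau> * (G x / B))"
        using pos nn by (intro mult_left_mono young) (simp_all add: C_def)
      finally show "F x powr (1 - \<tau>) * G x powr \<tau> \<le> C * ((1 - \<tau>) * (F x / A) + \<tau> * (G x / B))" .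
    qed (use int F G in auto)
    also have "\<dots> = C * ((1 - \<tau>) * (A / A) + \<tau> * (B / B))"
      using F G by (simp add: A_def B_def)
    also have "\<dots> = C" using pos by simp
    finally show ?thesis by (simp add: C_def)
  qed
qed

lemma in_Lp_integrable:
  assumes "in_Lp T 1 l"
  shows "set_integrable lebesgue {0..T} l" "Lp_norm T 1 l = (LINT s:{0..T}|lebesgue. \<bar>l s\<bar>)"
proof -
  show "set_integrable lebesgue {0..T} l"
    using assms unfolding in_Lp_def set_integrable_def set_borel_measurable_def
    by (auto elim!: Bochner_Integration.integrable_bound simp: abs_mult)
  have "0 \<le> (LINT s:{0..T}|lebesgue. \<bar>l s\<bar>)" by (simp add: set_lebesgue_integral_def)
  then show "Lp_norm T 1 l = (LINT s:{0..T}|lebesgue. \<bar>l s\<bar>)" by (simp add: Lp_norm_def)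
qed

text \<open>
  The kernel to the power \<open>1 / (1 - \<tau>)\<close> is again a power kernel, of order \<open>p = (\<gamma> - \<tau>) / (1 - \<tau>)\<close>.
  Its integral \<open>t powr p / p\<close>, raised to \<open>1 - \<tau>\<close> and divided by \<open>Gamma \<gamma>\<close>, is the factor in front of
  the norm of \<open>l\<close>.
\<close>

lemma abs_RL_integral_le:
  assumes h: "continuous_on {0..T} h" and t: "t \<in> {0..T}" and \<tau>: "0 < \<tau>" "\<tau> < 1" "\<tau> < \<gamma>"
    and l: "in_Lp T (1 / \<tau>) l" and le: "\<And>s. s \<in> {0..T} \<Longrightarrow> \<bar>h s\<bar> \<le> l s * N" and N: "0 \<le> N"
    and lnn: "\<And>s. s \<in> {0..T} \<Longrightarrow> 0 \<le> l s"
  shows "\<bar>RL_integral \<gamma> h t\<bar>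
    \<le> t powr (\<gamma> - \<tau>) / Gamma \<gamma> * ((1 - \<tau>) / (\<gamma> - \<tau>)) powr (1 - \<tau>) * Lp_norm T (1 / \<tau>) l * N"
proof -
  define p where "p = (\<gamma> - \<tau>) / (1 - \<tau>)"
  have p: "p > 0" using \<tau> by (simp add: p_def)
  have p1: "(p - 1) * (1 - \<tau>) = \<gamma> - 1" using \<tau> by (simp add: p_def field_simps)
  define F where "F s = indicat_real {0..t} s * (t - s) powr (p - 1)" for s
  define G where "G s = indicat_real {0..T} s * \<bar>l s\<bar> powr (1 / \<tau>)" for s
  have t0: "0 \<le> t" using t by auto
  have F: "integrable lebesgue F" "(\<integral>s. F s \<partial>lebesgue) = t powr p / p"
    using kern_power_integral[OF p t0] unfolding F_def
    by (auto simp: has_bochner_integral_iff integrable_completion integral_completion)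
  have G: "integrable lebesgue G" "(\<integral>s. G s \<partial>lebesgue) powr \<tau> = Lp_norm T (1 / \<tau>) l"
    using l unfolding G_def by (auto simp: in_Lp_def set_integrable_def Lp_norm_def set_lebesgue_integral_def)
  have nn: "0 \<le> F s" "0 \<le> G s" for s by (simp_all add: F_def G_def)
  note H = Holder_integral[OF F(1) G(1) nn \<tau>(1,2)]
  have FG: "F s powr (1 - \<tau>) * G s powr \<tau> = indicat_real {0..t} s * ((t - s) powr (\<gamma> - 1) * l s)" for s
    using t \<tau> lnn by (auto simp: F_def G_def powr_powr p1 indicator_def)
  have "\<bar>LINT s:{0..t}|lebesgue. (t - s) powr (\<gamma> - 1) * h s\<bar>
      \<le> (\<integral>s. F s powr (1 - \<tau>) * G s powr \<tau> * N \<partial>lebesgue)"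
    unfolding set_lebesgue_integral_def real_norm_def[symmetric]
  proof (rule Bochner_Integration.integral_norm_bound_integral)
    show "integrable lebesgue (\<lambda>s. indicat_real {0..t} s *\<^sub>R ((t - s) powr (\<gamma> - 1) * h s))"
      using RL_integrand_integrable[OF h t, of \<gamma>] \<tau> by (simp add: set_integrable_def)
    show "norm (indicat_real {0..t} s *\<^sub>R ((t - s) powr (\<gamma> - 1) * h s)) \<le> F s powr (1 - \<tau>) * G s powr \<tau> * N" for s
      unfolding FG using mult_left_mono[OF le[of s], of "(t - s) powr (\<gamma> - 1)"] t
      by (auto simp: indicator_def abs_mult mult.assoc)
  qed (use H in simp)
  also have "\<dots> = (\<integral>s. F s powr (1 - \<tau>) * G s powr \<tau> \<partial>lebesgue) * N" by simp
  also have "\<dots> \<le> (t powr p / p) powr (1 - \<tau>) * Lp_norm T (1 / \<tau>) l * N"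
    using H(2) N by (intro mult_right_mono) (simp_all add: F G)
  also have "(t powr p / p) powr (1 - \<tau>) = t powr (\<gamma> - \<tau>) * ((1 - \<tau>) / (\<gamma> - \<tau>)) powr (1 - \<tau>)"
  proof -
    have "t powr p / p = t powr p * ((1 - \<tau>) / (\<gamma> - \<tau>))" by (simp add: p_def)
    moreover have "p * (1 - \<tau>) = \<gamma> - \<tau>" using \<tau> by (simp add: p_def)
    ultimately show ?thesis using \<tau> by (simp only: powr_mult powr_powr)
  qed
  finally have "\<bar>LINT s:{0..t}|lebesgue. (t - s) powr (\<gamma> - 1) * h s\<bar> / Gamma \<gamma>
      \<le> t powr (\<gamma> - \<tau>) * ((1 - \<tau>) / (\<gamma> - \<tau>)) powr (1 - \<tau>) * Lp_norm T (1 / \<tau>) l * N / Gamma \<gamma>"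
    using \<tau> by (intro divide_right_mono Gamma_real_nonneg) auto
  moreover have "0 < Gamma \<gamma>" using \<tau> by simp
  ultimately show ?thesis
    by (simp add: RL_integral_def abs_mult)
qed

lemma abs_integral_diff_le:
  assumes "continuous_on ({0..T} \<times> UNIV) (g :: real \<times> real \<Rightarrow> real)"
    and u: "continuous_on {0..T} u" and v: "continuous_on {0..T} v"
    and l: "in_Lp T 1 l" "\<And>t. t \<in> {0..T} \<Longrightarrow> 0 \<le> l t"
    and lip: "\<And>t x y. t \<in> {0..T} \<Longrightarrow> \<bar>g (t, x) - g (t, y)\<bar> \<le> l t * \<bar>x - y\<bar>"
    and N: "\<And>t. t \<in> {0..T} \<Longrightarrow> \<bar>u t - v t\<bar> \<le> N"
  shows "\<bar>(LINT s:{0..T}|lebesgue. g (s, u s)) - (LINT s:{0..T}|lebesgue. g (s, v s))\<bar>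
    \<le> Lp_norm T 1 l * N"
proof -
  have cont: "continuous_on {0..T} (\<lambda>s. g (s, w s))" if "continuous_on {0..T} w" for w
    by (rule continuous_on_compose2[OF assms(1)]) (use that in \<open>auto intro!: continuous_intros\<close>)
  have int: "set_integrable lebesgue {0..T} (\<lambda>s. g (s, w s))" if "continuous_on {0..T} w" for w
    using absolutely_integrable_continuous_real[OF cont[OF that]] .
  have "(LINT s:{0..T}|lebesgue. g (s, u s)) - (LINT s:{0..T}|lebesgue. g (s, v s))
      = (LINT s:{0..T}|lebesgue. g (s, u s) - g (s, v s))"
    by (rule set_integral_diff(2)[OF int[OF u] int[OF v], symmetric])
  also have "\<bar>\<dots>\<bar> \<le> (LINT s:{0..T}|lebesgue. \<bar>l s\<bar> * N)"
    unfolding set_lebesgue_integral_def real_norm_def[symmetric]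
  proof (rule Bochner_Integration.integral_norm_bound_integral)
    show "integrable lebesgue (\<lambda>s. indicat_real {0..T} s *\<^sub>R (g (s, u s) - g (s, v s)))"
      using set_integral_diff(1)[OF int[OF u] int[OF v]] by (simp add: set_integrable_def)
    show "integrable lebesgue (\<lambda>s. indicat_real {0..T} s *\<^sub>R (norm (l s) * N))"
      using set_integrable_mult_left[OF set_integrable_norm[OF in_Lp_integrable(1)[OF l(1)]], of N]
      by (simp add: set_integrable_def)
    show "norm (indicat_real {0..T} s *\<^sub>R (g (s, u s) - g (s, v s)))
        \<le> indicat_real {0..T} s *\<^sub>R (norm (l s) * N)" for s
      using order_trans[OF lip[of s "u s" "v s"] mult_left_mono[OF N[of s] l(2)[of s]]] l(2)[of s]
      by (auto simp: indicator_def)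
  qed
  also have "\<dots> = Lp_norm T 1 l * N"
    using in_Lp_integrable(2)[OF l(1)] by simp
  finally show ?thesis .
qed

section \<open>The linear boundary value problem\<close>

locale three_point_bvp =
  fixes T \<eta> \<alpha> :: real and \<beta> a b :: "nat \<Rightarrow> real"
  assumes T: "0 < T" and \<eta>: "0 < \<eta>" "\<eta> < T" and \<alpha>: "2 < \<alpha>"
    and \<beta>0: "\<beta> 0 = 0" and \<beta>1: "0 < \<beta> 1" "\<beta> 1 \<le> 1" and \<beta>2: "1 < \<beta> 2" "\<beta> 2 \<le> 2"
    and ab0: "a 0 + b 0 \<noteq> 0"
    and ab1: "a 1 * \<eta> powr (1 - \<beta> 1) + b 1 * T powr (1 - \<beta> 1) \<noteq> 0"
    and ab2: "\<And>i. i \<in> {1, 2} \<Longrightarrow> a i * \<eta> powr (2 - \<beta> i) + b i * T powr (2 - \<beta> i) \<noteq> 0"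
begin

text \<open>
  The contribution of the fractional integrals of \<open>h\<close> to the \<open>i\<close>-th boundary form, whose left node is \<open>0\<close>
  for \<open>i = 0\<close> and \<open>\<eta>\<close> otherwise.
\<close>

definition bdry :: "(real \<Rightarrow> real) \<Rightarrow> nat \<Rightarrow> real" where
  "bdry h i = a i * RL_integral (\<alpha> - \<beta> i) h (if i = 0 then 0 else \<eta>) + b i * RL_integral (\<alpha> - \<beta> i) h T"

text \<open>
  The integration constants \<open>k2\<close>, \<open>k1\<close>, \<open>k0\<close>, obtained by solving the boundary conditions from the last
  one upwards. The argument \<open>X i\<close> is \<open>bdry h i\<close> minus the prescribed value of the \<open>i\<close>-th condition.
\<close>

definition coeff2 :: "(nat \<Rightarrow> real) \<Rightarrow> real" where
  "coeff2 X = \<mu> T \<eta> \<beta> a b 2 * X 2"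

definition coeff1 :: "(nat \<Rightarrow> real) \<Rightarrow> real" where
  "coeff1 X = \<nu> T \<eta> \<beta> a b * (X 1 - coeff2 X / \<mu> T \<eta> \<beta> a b 1)"

definition coeff0 :: "(nat \<Rightarrow> real) \<Rightarrow> real" where
  "coeff0 X = (X 0 - b 0 * T * coeff1 X - b 0 * T\<^sup>2 * coeff2 X) / (a 0 + b 0)"

text \<open>
  The solution of the linear problem and the formulas for its two Caputo derivatives.
\<close>

definition sol :: "(real \<Rightarrow> real) \<Rightarrow> (nat \<Rightarrow> real) \<Rightarrow> real \<Rightarrow> real" where
  "sol h X t = RL_integral \<alpha> h t - coeff0 X - coeff1 X * t - coeff2 X * t\<^sup>2"

definition sol_D1 :: "(real \<Rightarrow> real) \<Rightarrow> (nat \<Rightarrow> real) \<Rightarrow> real \<Rightarrow> real" where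
  "sol_D1 h X t = RL_integral (\<alpha> - \<beta> 1) h t - coeff1 X * fpow (1 - \<beta> 1) t
     - 2 * coeff2 X * fpow (2 - \<beta> 1) t"

definition sol_D2 :: "(real \<Rightarrow> real) \<Rightarrow> (nat \<Rightarrow> real) \<Rightarrow> real \<Rightarrow> real" where
  "sol_D2 h X t = RL_integral (\<alpha> - \<beta> 2) h t - 2 * coeff2 X * fpow (2 - \<beta> 2) t"

lemma Gamma_pos: "0 < Gamma (3 - \<beta> 1)" "0 < Gamma (3 - \<beta> 2)" "0 < Gamma (2 - \<beta> 1)"
  using \<beta>1 \<beta>2 by simp_all

lemma \<mu>_nonzero: "\<mu> T \<eta> \<beta> a b 1 \<noteq> 0" "\<mu> T \<eta> \<beta> a b 2 \<noteq> 0"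
  using Gamma_pos ab2[of 1] ab2[of 2] by (simp_all add: \<mu>_def)

lemma \<nu>_nonzero: "\<nu> T \<eta> \<beta> a b \<noteq> 0"
  using Gamma_pos ab1 by (simp add: \<nu>_def)

text \<open>
  The boundary forms are evaluated at the Caputo derivatives of \<open>t\<close> (the first line) and of \<open>t\<^sup>2\<close>, whose
  factor \<open>2\<close> is the one in the definition of \<open>\<mu>\<close>.
\<close>

lemma boundary_fpow:
  shows "a 1 * fpow (1 - \<beta> 1) \<eta> + b 1 * fpow (1 - \<beta> 1) T = 1 / \<nu> T \<eta> \<beta> a b"
    and "2 * (a 1 * fpow (2 - \<beta> 1) \<eta> + b 1 * fpow (2 - \<beta> 1) T) = 1 / \<mu> T \<eta> \<beta> a b 1"
    and "2 * (a 2 * fpow (2 - \<beta> 2) \<eta> + b 2 * fpow (2 - \<beta> 2) T) = 1 / \<mu> T \<eta> \<beta> a b 2"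
  using Gamma_pos T \<eta> by (simp_all add: \<mu>_def \<nu>_def fpow_pos_eq add_divide_distrib add.commute)

text \<open>
  The system is triangular: the third condition contains only \<open>k2\<close>, the second only \<open>k1\<close> and \<open>k2\<close>, and
  each diagonal entry is nonzero.
\<close>

lemma boundary_conditions_iff_coeffs:
  "(a 0 * (RL_integral \<alpha> h 0 - k0 - k1 * 0 - k2 * 0\<^sup>2) + b 0 * (RL_integral \<alpha> h T - k0 - k1 * T - k2 * T\<^sup>2) = d 0 \<and>
    a 1 * (RL_integral (\<alpha> - \<beta> 1) h \<eta> - k1 * fpow (1 - \<beta> 1) \<eta> - 2 * k2 * fpow (2 - \<beta> 1) \<eta>) +
    b 1 * (RL_integral (\<alpha> - \<beta> 1) h T - k1 * fpow (1 - \<beta> 1) T - 2 * k2 * fpow (2 - \<beta> 1) T) = d 1 \<and>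
    a 2 * (RL_integral (\<alpha> - \<beta> 2) h \<eta> - 2 * k2 * fpow (2 - \<beta> 2) \<eta>) +
    b 2 * (RL_integral (\<alpha> - \<beta> 2) h T - 2 * k2 * fpow (2 - \<beta> 2) T) = d 2)
   \<longleftrightarrow> k0 = coeff0 (\<lambda>i. bdry h i - d i) \<and> k1 = coeff1 (\<lambda>i. bdry h i - d i) \<and> k2 = coeff2 (\<lambda>i. bdry h i - d i)"
  (is "?E0 \<and> ?E1 \<and> ?E2 \<longleftrightarrow> _")
proof -
  let ?X = "\<lambda>i. bdry h i - d i"
  have "?E2 \<longleftrightarrow> bdry h 2 - k2 * (2 * (a 2 * fpow (2 - \<beta> 2) \<eta> + b 2 * fpow (2 - \<beta> 2) T)) = d 2"
    by (simp add: bdry_def algebra_simps)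
  then have E2: "?E2 \<longleftrightarrow> k2 = coeff2 ?X"
    unfolding boundary_fpow using \<mu>_nonzero by (auto simp: coeff2_def field_simps)
  have "?E1 \<longleftrightarrow> bdry h 1 - k1 * (a 1 * fpow (1 - \<beta> 1) \<eta> + b 1 * fpow (1 - \<beta> 1) T)
      - k2 * (2 * (a 1 * fpow (2 - \<beta> 1) \<eta> + b 1 * fpow (2 - \<beta> 1) T)) = d 1"
    by (simp add: bdry_def algebra_simps)
  then have "?E1 \<longleftrightarrow> k1 / \<nu> T \<eta> \<beta> a b = ?X 1 - k2 / \<mu> T \<eta> \<beta> a b 1"
    unfolding boundary_fpow by (auto simp: algebra_simps)
  then have E1: "?E1 \<longleftrightarrow> k1 = \<nu> T \<eta> \<beta> a b * (?X 1 - k2 / \<mu> T \<eta> \<beta> a b 1)"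
    using \<nu>_nonzero by (auto simp: field_simps)
  have "?E0 \<longleftrightarrow> (a 0 + b 0) * k0 = ?X 0 - b 0 * T * k1 - b 0 * T\<^sup>2 * k2"
    by (simp add: bdry_def \<beta>0) (auto simp: algebra_simps)
  then have E0: "?E0 \<longleftrightarrow> k0 = (?X 0 - b 0 * T * k1 - b 0 * T\<^sup>2 * k2) / (a 0 + b 0)"
    using ab0 by (auto simp: field_simps)
  show ?thesis unfolding E0 E1 E2 by (auto simp: coeff0_def coeff1_def)
qed

context
  fixes h u :: "real \<Rightarrow> real" and X :: "nat \<Rightarrow> real"
  assumes h: "continuous_on {0..T} h" and u: "\<And>t. t \<in> {0..T} \<Longrightarrow> u t = sol h X t"
begin

lemma sol_cont_diff: "cont_diff_on T 2 u"
  using solution_cont_diff[OF T \<alpha> h u[unfolded sol_def]] .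

lemma caputo_sol:
  assumes "t \<in> {0..T}"
  shows "caputo T (\<beta> 1) u t = sol_D1 h X t" "caputo T (\<beta> 2) u t = sol_D2 h X t"
  using caputo_solution_1[OF T \<alpha> h u[unfolded sol_def] \<beta>1 assms]
    caputo_solution_2[OF T \<alpha> h u[unfolded sol_def] \<beta>2 assms]
  by (simp_all add: sol_D1_def sol_D2_def)

end

text \<open>
  Existence and uniqueness for the linear problem at once: the equation leaves three constants free, and
  the boundary conditions fix them.
\<close>

lemma linear_bvp_iff:
  assumes h: "continuous_on {0..T} h"
  shows "(solves_caputo_eq T \<alpha> h u \<and>
      a 0 * u 0 + b 0 * u T = d 0 \<and>
      a 1 * caputo T (\<beta> 1) u \<eta> + b 1 * caputo T (\<beta> 1) u T = d 1 \<and>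
      a 2 * caputo T (\<beta> 2) u \<eta> + b 2 * caputo T (\<beta> 2) u T = d 2)
    \<longleftrightarrow> (\<forall>t\<in>{0..T}. u t = sol h (\<lambda>i. bdry h i - d i) t)"
    (is "?L \<longleftrightarrow> ?R")
proof -
  let ?X = "\<lambda>i. bdry h i - d i"
  have mem: "0 \<in> {0..T}" "T \<in> {0..T}" "\<eta> \<in> {0..T}" using T \<eta> by auto
  have *: "(a 0 * u 0 + b 0 * u T = d 0 \<and>
      a 1 * caputo T (\<beta> 1) u \<eta> + b 1 * caputo T (\<beta> 1) u T = d 1 \<and>
      a 2 * caputo T (\<beta> 2) u \<eta> + b 2 * caputo T (\<beta> 2) u T = d 2)
      \<longleftrightarrow> k0 = coeff0 ?X \<and> k1 = coeff1 ?X \<and> k2 = coeff2 ?X"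
    if u: "\<And>t. t \<in> {0..T} \<Longrightarrow> u t = RL_integral \<alpha> h t - k0 - k1 * t - k2 * t\<^sup>2" for k0 k1 k2
  proof -
    have c1: "caputo T (\<beta> 1) u t = RL_integral (\<alpha> - \<beta> 1) h t - k1 * fpow (1 - \<beta> 1) t - 2 * k2 * fpow (2 - \<beta> 1) t"
      and c2: "caputo T (\<beta> 2) u t = RL_integral (\<alpha> - \<beta> 2) h t - 2 * k2 * fpow (2 - \<beta> 2) t"
      if "t \<in> {0..T}" for t
      using caputo_solution_1[OF T \<alpha> h u \<beta>1 that] caputo_solution_2[OF T \<alpha> h u \<beta>2 that] by blast+
    show ?thesis
      unfolding boundary_conditions_iff_coeffs[symmetric] u[OF mem(1)] u[OF mem(2)] c1[OF mem(2)] c1[OF mem(3)]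
        c2[OF mem(2)] c2[OF mem(3)] ..
  qed
  show ?thesis
  proof
    assume L: ?L
    then obtain k0 k1 k2 where u: "\<And>t. t \<in> {0..T} \<Longrightarrow> u t = RL_integral \<alpha> h t - k0 - k1 * t - k2 * t\<^sup>2"
      unfolding solves_caputo_eq_def by blast
    show ?R using *[OF u] L u by (simp add: sol_def)
  next
    assume R: ?R
    then have u: "\<And>t. t \<in> {0..T} \<Longrightarrow> u t = RL_integral \<alpha> h t - coeff0 ?X - coeff1 ?X * t - coeff2 ?X * t\<^sup>2"
      by (simp add: sol_def)
    then have "solves_caputo_eq T \<alpha> h u" unfolding solves_caputo_eq_def by blast
    then show ?L using *[OF u] by blast
  qed
qed

lemma continuous_on_sol:
  assumes h: "continuous_on {0..T} h"
  shows "continuous_on {0..T} (sol h X)" "continuous_on {0..T} (sol_D1 h X)" "continuous_on {0..T} (sol_D2 h X)"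
  unfolding sol_def[abs_def] sol_D1_def[abs_def] sol_D2_def[abs_def]
  using \<alpha> \<beta>1 \<beta>2 by (auto intro!: continuous_intros continuous_on_RL_integral continuous_on_fpow h)

lemma coeff_diff:
  "coeff2 (\<lambda>i. X i - Y i) = coeff2 X - coeff2 Y"
  "coeff1 (\<lambda>i. X i - Y i) = coeff1 X - coeff1 Y"
  "coeff0 (\<lambda>i. X i - Y i) = coeff0 X - coeff0 Y"
  by (simp_all add: coeff0_def coeff1_def coeff2_def algebra_simps diff_divide_distrib add_divide_distrib)

lemma \<alpha>_\<beta>_pos: "i \<in> {0, 1, 2} \<Longrightarrow> 0 < \<alpha> - \<beta> i"
  using \<alpha> \<beta>0 \<beta>1 \<beta>2 by auto

lemma bdry_diff:
  assumes h: "continuous_on {0..T} h" and k: "continuous_on {0..T} k" and i: "i \<in> {0, 1, 2}"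
  shows "bdry (\<lambda>t. h t - k t) i = bdry h i - bdry k i"
proof -
  have "RL_integral (\<alpha> - \<beta> i) (\<lambda>t. h t - k t) t = RL_integral (\<alpha> - \<beta> i) h t - RL_integral (\<alpha> - \<beta> i) k t"
    if "t \<in> {0, \<eta>, T}" for t
    using that T \<eta> by (intro RL_integral_diff[OF h k _ \<alpha>_\<beta>_pos[OF i]]) auto
  then show ?thesis by (simp add: bdry_def right_diff_distrib)
qed

text \<open>
  The solution formulas are linear in the right-hand side and the boundary data jointly, so bounds for
  one solution are Lipschitz bounds.
\<close>

lemma sol_diff:
  assumes h: "continuous_on {0..T} h" and k: "continuous_on {0..T} k" and t: "t \<in> {0..T}"
  shows "sol h X t - sol k Y t = sol (\<lambda>t. h t - k t) (\<lambda>i. X i - Y i) t"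
    and "sol_D1 h X t - sol_D1 k Y t = sol_D1 (\<lambda>t. h t - k t) (\<lambda>i. X i - Y i) t"
    and "sol_D2 h X t - sol_D2 k Y t = sol_D2 (\<lambda>t. h t - k t) (\<lambda>i. X i - Y i) t"
  using RL_integral_diff[OF h k t] \<alpha>_\<beta>_pos[of 0] \<alpha>_\<beta>_pos[of 1] \<alpha>_\<beta>_pos[of 2] \<beta>0
  by (simp_all add: sol_def sol_D1_def sol_D2_def coeff_diff algebra_simps)

lemma abs_coeff2: "\<bar>coeff2 X\<bar> = \<bar>\<mu> T \<eta> \<beta> a b 2\<bar> * \<bar>X 2\<bar>"
  by (simp add: coeff2_def abs_mult)

lemma abs_coeff1_le:
  "\<bar>coeff1 X\<bar> \<le> \<bar>\<nu> T \<eta> \<beta> a b\<bar> * (\<bar>X 1\<bar> + \<bar>\<mu> T \<eta> \<beta> a b 2\<bar> / \<bar>\<mu> T \<eta> \<beta> a b 1\<bar> * \<bar>X 2\<bar>)"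
proof -
  have "\<bar>X 1 - coeff2 X / \<mu> T \<eta> \<beta> a b 1\<bar> \<le> \<bar>X 1\<bar> + \<bar>\<mu> T \<eta> \<beta> a b 2\<bar> / \<bar>\<mu> T \<eta> \<beta> a b 1\<bar> * \<bar>X 2\<bar>"
    using abs_triangle_ineq4[of "X 1" "coeff2 X / \<mu> T \<eta> \<beta> a b 1"] by (simp add: abs_coeff2)
  then show ?thesis by (simp add: coeff1_def abs_mult mult_left_mono)
qed

lemma abs_coeff0_le:
  "\<bar>coeff0 X\<bar> \<le> (\<bar>X 0\<bar> + \<bar>b 0\<bar> * T * \<bar>coeff1 X\<bar> + \<bar>b 0\<bar> * T\<^sup>2 * \<bar>coeff2 X\<bar>) / \<bar>a 0 + b 0\<bar>"
proof -
  have "\<bar>X 0 - b 0 * T * coeff1 X - b 0 * T\<^sup>2 * coeff2 X\<bar>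
      \<le> \<bar>X 0\<bar> + \<bar>b 0 * T * coeff1 X\<bar> + \<bar>b 0 * T\<^sup>2 * coeff2 X\<bar>" by linarith
  then show ?thesis
    using T by (simp add: coeff0_def abs_mult divide_right_mono)
qed

text \<open>
  The triangle inequality, bounding the constants from \<open>coeff2\<close> to \<open>coeff0\<close>. Both \<open>coeff1\<close>
  and \<open>coeff2\<close> enter twice, directly and through \<open>coeff0\<close>, whence the factor \<open>B + 1\<close>.
\<close>

lemma abs_sol_le:
  assumes t: "t \<in> {0..T}"
  shows "\<bar>sol h X t\<bar> \<le> \<bar>RL_integral \<alpha> h t\<bar> + (\<Sum>i=0..2. rho T \<eta> \<beta> a b i * \<bar>X i\<bar>)"
proof -
  define m where "m = \<bar>\<mu> T \<eta> \<beta> a b 2\<bar>"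
  define r where "r = \<bar>\<mu> T \<eta> \<beta> a b 2\<bar> / \<bar>\<mu> T \<eta> \<beta> a b 1\<bar>"
  define n where "n = \<bar>\<nu> T \<eta> \<beta> a b\<bar>"
  define B where "B = \<bar>b 0\<bar> / \<bar>a 0 + b 0\<bar>"
  have nn: "0 \<le> B" by (simp add: B_def)
  have tt: "0 \<le> t" "t \<le> T" "t\<^sup>2 \<le> T\<^sup>2" using t by (auto intro: power_mono)
  have "\<bar>sol h X t\<bar> \<le> \<bar>RL_integral \<alpha> h t\<bar> + \<bar>coeff0 X\<bar> + \<bar>coeff1 X * t\<bar> + \<bar>coeff2 X * t\<^sup>2\<bar>"
    unfolding sol_def by linarith
  also have "\<bar>coeff1 X * t\<bar> \<le> \<bar>coeff1 X\<bar> * T" using tt by (simp add: abs_mult mult_left_mono)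
  also have "\<bar>coeff2 X * t\<^sup>2\<bar> \<le> \<bar>coeff2 X\<bar> * T\<^sup>2" using tt by (simp add: abs_mult mult_left_mono)
  also have "\<bar>coeff0 X\<bar> \<le> \<bar>X 0\<bar> / \<bar>a 0 + b 0\<bar> + B * T * \<bar>coeff1 X\<bar> + B * T\<^sup>2 * \<bar>coeff2 X\<bar>"
    using abs_coeff0_le[of X] by (simp add: B_def add_divide_distrib)
  also have "\<bar>RL_integral \<alpha> h t\<bar> + (\<bar>X 0\<bar> / \<bar>a 0 + b 0\<bar> + B * T * \<bar>coeff1 X\<bar> + B * T\<^sup>2 * \<bar>coeff2 X\<bar>)
       + \<bar>coeff1 X\<bar> * T + \<bar>coeff2 X\<bar> * T\<^sup>2
      = \<bar>RL_integral \<alpha> h t\<bar> + \<bar>X 0\<bar> / \<bar>a 0 + b 0\<bar> + (B + 1) * T * \<bar>coeff1 X\<bar> + (B + 1) * T\<^sup>2 * \<bar>coeff2 X\<bar>"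
    by (simp add: algebra_simps)
  also have "\<dots> \<le> \<bar>RL_integral \<alpha> h t\<bar> + \<bar>X 0\<bar> / \<bar>a 0 + b 0\<bar> + (B + 1) * T * (n * (\<bar>X 1\<bar> + r * \<bar>X 2\<bar>))
      + (B + 1) * T\<^sup>2 * (m * \<bar>X 2\<bar>)"
    using abs_coeff1_le[of X] T nn unfolding abs_coeff2 m_def r_def n_def
    by (intro add_mono mult_left_mono) auto
  also have "\<dots> = \<bar>RL_integral \<alpha> h t\<bar> + (\<Sum>i=0..2. rho T \<eta> \<beta> a b i * \<bar>X i\<bar>)"
  proof -
    have "rho T \<eta> \<beta> a b 0 = 1 / \<bar>a 0 + b 0\<bar>" "rho T \<eta> \<beta> a b 1 = n * (B + 1) * T"
      "rho T \<eta> \<beta> a b 2 = B * m * T\<^sup>2 + B * n * r * T + n * r * T + m * T\<^sup>2"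
      by (simp_all add: rho_def Let_def B_def m_def n_def r_def)
    then show ?thesis
      by (simp add: numeral_2_eq_2 sum.atLeast0_atMost_Suc) (simp add: algebra_simps)
  qed
  finally show ?thesis by linarith
qed

lemma fpow_bounds:
  assumes "t \<in> {0..T}"
  shows "\<bar>fpow (1 - \<beta> 1) t\<bar> \<le> T powr (1 - \<beta> 1) / Gamma (2 - \<beta> 1)"
    and "i \<in> {1, 2} \<Longrightarrow> \<bar>fpow (2 - \<beta> i) t\<bar> \<le> T powr (2 - \<beta> i) / Gamma (3 - \<beta> i)"
  using fpow_le[of t T "1 - \<beta> 1"] fpow_le[of t T "2 - \<beta> i"] assms T \<beta>1 \<beta>2
  by (auto simp: add.commute)

lemma abs_sol_D1_le:
  assumes t: "t \<in> {0..T}"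
  shows "\<bar>sol_D1 h X t\<bar> \<le> \<bar>RL_integral (\<alpha> - \<beta> 1) h t\<bar> + (\<Sum>i=1..2. rho_tilde T \<eta> \<beta> a b i * \<bar>X i\<bar>)"
proof -
  define P where "P = T powr (1 - \<beta> 1) / Gamma (2 - \<beta> 1)"
  define Q where "Q = T powr (2 - \<beta> 1) / Gamma (3 - \<beta> 1)"
  have P: "0 \<le> P" "0 \<le> Q" using Gamma_pos by (simp_all add: P_def Q_def)
  have "\<bar>sol_D1 h X t\<bar> \<le> \<bar>RL_integral (\<alpha> - \<beta> 1) h t\<bar> + \<bar>coeff1 X\<bar> * \<bar>fpow (1 - \<beta> 1) t\<bar> + 2 * \<bar>coeff2 X\<bar> * \<bar>fpow (2 - \<beta> 1) t\<bar>"
    unfolding sol_D1_def abs_mult[symmetric] mult.assoc by linarith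
  also have "\<dots> \<le> \<bar>RL_integral (\<alpha> - \<beta> 1) h t\<bar> + \<bar>coeff1 X\<bar> * P + 2 * \<bar>coeff2 X\<bar> * Q"
    using fpow_bounds(1)[OF t] fpow_bounds(2)[OF t, of 1] unfolding P_def Q_def
    by (intro add_mono mult_left_mono) auto
  also have "\<dots> \<le> \<bar>RL_integral (\<alpha> - \<beta> 1) h t\<bar> +
      \<bar>\<nu> T \<eta> \<beta> a b\<bar> * (\<bar>X 1\<bar> + \<bar>\<mu> T \<eta> \<beta> a b 2\<bar> / \<bar>\<mu> T \<eta> \<beta> a b 1\<bar> * \<bar>X 2\<bar>) * P
      + 2 * (\<bar>\<mu> T \<eta> \<beta> a b 2\<bar> * \<bar>X 2\<bar>) * Q"
    using P abs_coeff1_le[of X] unfolding abs_coeff2 by (intro add_mono mult_right_mono) auto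
  also have "\<dots> = \<bar>RL_integral (\<alpha> - \<beta> 1) h t\<bar> + (\<Sum>i=1..2. rho_tilde T \<eta> \<beta> a b i * \<bar>X i\<bar>)"
  proof -
    have "{1..2::nat} = {1, 2}" by auto
    then show ?thesis by (simp add: rho_tilde_def Let_def P_def Q_def) (simp add: algebra_simps add_divide_distrib)
  qed
  finally show ?thesis .
qed

lemma abs_sol_D2_le:
  assumes t: "t \<in> {0..T}"
  shows "\<bar>sol_D2 h X t\<bar> \<le> \<bar>RL_integral (\<alpha> - \<beta> 2) h t\<bar> + rho_hat T \<eta> \<beta> a b 2 * \<bar>X 2\<bar>"
proof -
  have "\<bar>sol_D2 h X t\<bar> \<le> \<bar>RL_integral (\<alpha> - \<beta> 2) h t\<bar> + 2 * \<bar>coeff2 X\<bar> * \<bar>fpow (2 - \<beta> 2) t\<bar>"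
    unfolding sol_D2_def abs_mult[symmetric] mult.assoc by linarith
  also have "\<dots> \<le> \<bar>RL_integral (\<alpha> - \<beta> 2) h t\<bar> + 2 * \<bar>coeff2 X\<bar> * (T powr (2 - \<beta> 2) / Gamma (3 - \<beta> 2))"
    using fpow_bounds(2)[OF t, of 2] by (intro add_mono mult_left_mono) auto
  also have "\<dots> = \<bar>RL_integral (\<alpha> - \<beta> 2) h t\<bar> + rho_hat T \<eta> \<beta> a b 2 * \<bar>X 2\<bar>"
    by (simp add: rho_hat_def abs_coeff2)
  finally show ?thesis .
qed

lemma rho_nonneg: "0 \<le> rho T \<eta> \<beta> a b i" "0 \<le> rho_tilde T \<eta> \<beta> a b i" "0 \<le> rho_hat T \<eta> \<beta> a b i"
  using T Gamma_pos by (auto simp: rho_def rho_tilde_def rho_hat_def Let_def)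

end

section \<open>The contraction on triples of functions\<close>

text \<open>
  Here \<open>D\<close> is bounded above and below by multiples of the distance, but a map contracting \<open>D\<close> need not
  contract the distance itself. A sufficiently high iterate does, because \<open>C * q ^ n\<close> tends to \<open>0\<close>; its unique
  fixed point is fixed by the map too. It serves to replace the Euclidean distance on products by the sum
  of the distances of the components.
\<close>

lemma contraction_equivalent_metric:
  fixes \<Phi> :: "'a::complete_space \<Rightarrow> 'a" and D :: "'a \<Rightarrow> 'a \<Rightarrow> real"
  assumes q: "0 \<le> q" "q < 1" and C: "0 < C"
    and D: "\<And>x y. dist x y \<le> D x y" "\<And>x y. D x y \<le> C * dist x y"
    and contr: "\<And>x y. D (\<Phi> x) (\<Phi> y) \<le> q * D x y"
  shows "\<exists>!x. \<Phi> x = x"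
proof -
  have iter: "D ((\<Phi> ^^ n) x) ((\<Phi> ^^ n) y) \<le> q ^ n * D x y" for n x y
  proof (induction n)
    case (Suc n)
    have "D ((\<Phi> ^^ Suc n) x) ((\<Phi> ^^ Suc n) y) \<le> q * D ((\<Phi> ^^ n) x) ((\<Phi> ^^ n) y)"
      using contr by simp
    also have "\<dots> \<le> q * (q ^ n * D x y)" using Suc q by (intro mult_left_mono)
    finally show ?case by (simp add: mult.assoc)
  qed simp
  obtain n where n: "q ^ n < 1 / C"
    using real_arch_pow_inv[of "1 / C" q] C q by auto
  have "\<exists>!x. (\<Phi> ^^ n) x = x"
  proof (rule banach_fix_type)
    show "0 \<le> q ^ n * C" "q ^ n * C < 1" using n C q by (simp_all add: field_simps)
    show "\<forall>x y. dist ((\<Phi> ^^ n) x) ((\<Phi> ^^ n) y) \<le> q ^ n * C * dist x y"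
    proof (intro allI)
      fix x y
      have "dist ((\<Phi> ^^ n) x) ((\<Phi> ^^ n) y) \<le> q ^ n * D x y" using D(1) iter by (rule order_trans)
      also have "\<dots> \<le> q ^ n * (C * dist x y)" using D(2) q by (intro mult_left_mono) auto
      finally show "dist ((\<Phi> ^^ n) x) ((\<Phi> ^^ n) y) \<le> q ^ n * C * dist x y" by (simp add: mult.assoc)
    qed
  qed
  then obtain x where x: "(\<Phi> ^^ n) x = x" and uniq: "\<And>y. (\<Phi> ^^ n) y = y \<Longrightarrow> y = x" by auto
  have "(\<Phi> ^^ n) (\<Phi> x) = \<Phi> x" using x by (metis funpow_swap1)
  then have "\<Phi> x = x" by (rule uniq)
  moreover have "y = x" if "\<Phi> y = y" for y
  proof (rule uniq)
    show "(\<Phi> ^^ n) y = y" by (induction n) (simp_all add: that)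
  qed
  ultimately show ?thesis by blast
qed

text \<open>
  Continuous functions on \<open>[0,T]\<close> are identified with their constant extensions to the line, which are
  bounded continuous functions and thus elements of a complete metric space.
\<close>

definition clamp_ext :: "real \<Rightarrow> (real \<Rightarrow> real) \<Rightarrow> real \<Rightarrow>\<^sub>C real" where
  "clamp_ext T w = (SOME g. \<forall>t. apply_bcontfun g t = w (clamp 0 T t))"

lemma apply_clamp_ext:
  assumes "continuous_on {0..T} w"
  shows "clamp_ext T w t = w (clamp 0 T t)"
proof -
  from assms have "continuous_on (cbox 0 T) w" by simp
  then obtain g :: "real \<Rightarrow>\<^sub>C real" where "\<And>t. g t = w (clamp 0 T t)"
    by (rule continuous_on_cbox_bcontfunE) (erule that)
  then have "\<forall>t. clamp_ext T w t = w (clamp 0 T t)"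
    unfolding clamp_ext_def by (intro someI[where P="\<lambda>g. \<forall>t. apply_bcontfun g t = w (clamp 0 T t)"]) auto
  then show ?thesis by blast
qed

lemma apply_clamp_ext_inside:
  assumes "continuous_on {0..T} w" "t \<in> {0..T}"
  shows "clamp_ext T w t = w t"
  using assms by (simp add: apply_clamp_ext)

lemma clamp_mem: "0 \<le> T \<Longrightarrow> clamp 0 T t \<in> {0..T::real}"
  using clamp_in_interval[of 0 T t] by simp

lemma clamp_ext_cong:
  assumes "0 \<le> T" "continuous_on {0..T} v" "continuous_on {0..T} w" "\<And>t. t \<in> {0..T} \<Longrightarrow> v t = w t"
  shows "clamp_ext T v = clamp_ext T w"
  using assms clamp_mem by (intro bcontfun_eqI) (simp add: apply_clamp_ext)

lemma dist_clamp_ext_le: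
  assumes "0 \<le> T" "continuous_on {0..T} v" "continuous_on {0..T} w"
    and "\<And>t. t \<in> {0..T} \<Longrightarrow> \<bar>v t - w t\<bar> \<le> c"
  shows "dist (clamp_ext T v) (clamp_ext T w) \<le> c"
  using assms clamp_mem[OF assms(1)] by (intro dist_bound) (simp add: apply_clamp_ext dist_real_def)

context three_point_bvp
begin

lemma sol_cong:
  assumes "\<And>s. s \<in> {0..T} \<Longrightarrow> h s = k s" "t \<in> {0..T}"
  shows "sol h X t = sol k X t" "sol_D1 h X t = sol_D1 k X t" "sol_D2 h X t = sol_D2 k X t" "bdry h i = bdry k i"
proof -
  have "RL_integral \<gamma> h s = RL_integral \<gamma> k s" if "s \<in> {0..T}" for s \<gamma>
    using that assms(1) by (intro RL_integral_cong) auto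
  then show "sol h X t = sol k X t" "sol_D1 h X t = sol_D1 k X t" "sol_D2 h X t = sol_D2 k X t" "bdry h i = bdry k i"
    using assms(2) T \<eta> by (simp_all add: sol_def sol_D1_def sol_D2_def bdry_def)
qed

text \<open>
  A solution is twice continuously differentiable, so its Caputo derivatives and hence the right-hand side
  along it are continuous, and the linear theory applies to it.
\<close>

lemma bvp_solution_imp_fixed:
  fixes lam :: "nat \<Rightarrow> real" and f :: "real \<times> real \<times> real \<times> real \<Rightarrow> real"
    and g :: "nat \<Rightarrow> real \<times> real \<Rightarrow> real"
  assumes f: "continuous_on ({0..T} \<times> UNIV) f" and u: "bvp_solution T \<eta> \<alpha> \<beta> a b lam f g u"
  defines "v \<equiv> caputo T (\<beta> 1) u" and "w \<equiv> caputo T (\<beta> 2) u"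
  defines "h \<equiv> \<lambda>t. f (t, u t, v t, w t)"
  defines "X \<equiv> \<lambda>i. bdry h i - lam i * (LINT s:{0..T}|lebesgue. g i (s, u s))"
  shows "continuous_on {0..T} u" "continuous_on {0..T} v" "continuous_on {0..T} w"
    and "\<And>t. t \<in> {0..T} \<Longrightarrow> u t = sol h X t \<and> v t = sol_D1 h X t \<and> w t = sol_D2 h X t"
proof -
  have C2: "cont_diff_on T 2 u" using u by (simp add: bvp_solution_def)
  show cu: "continuous_on {0..T} u" using continuous_on_nderiv[OF C2, of 0] by simp
  show cv: "continuous_on {0..T} v" and cw: "continuous_on {0..T} w"
    unfolding v_def w_def using \<beta>1 \<beta>2 by (auto intro: continuous_on_caputo[OF C2])
  have h: "continuous_on {0..T} h"
    unfolding h_def by (rule continuous_on_compose2[OF f]) (auto intro!: continuous_intros cu cv cw)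
  have "\<forall>t\<in>{0..T}. u t = sol h X t"
    using u unfolding X_def bvp_solution_def h_def v_def w_def
    by (intro linear_bvp_iff[THEN iffD1] h[unfolded h_def v_def w_def]) auto
  then have uX: "\<And>t. t \<in> {0..T} \<Longrightarrow> u t = sol h X t" by blast
  show "u t = sol h X t \<and> v t = sol_D1 h X t \<and> w t = sol_D2 h X t" if "t \<in> {0..T}" for t
    using uX[OF that] caputo_sol[OF h uX that] by (simp add: v_def w_def)
qed

text \<open>
  For a fixed triple, the formula for the first component already determines its Caputo derivatives, which
  therefore coincide with the other two components.
\<close>

lemma fixed_imp_bvp_solution:
  fixes lam :: "nat \<Rightarrow> real" and f :: "real \<times> real \<times> real \<times> real \<Rightarrow> real"
    and g :: "nat \<Rightarrow> real \<times> real \<Rightarrow> real"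
  assumes f: "continuous_on ({0..T} \<times> UNIV) f"
    and cont: "continuous_on {0..T} u" "continuous_on {0..T} v" "continuous_on {0..T} w"
  defines "h \<equiv> \<lambda>t. f (t, u t, v t, w t)"
  defines "X \<equiv> \<lambda>i. bdry h i - lam i * (LINT s:{0..T}|lebesgue. g i (s, u s))"
  assumes fixed: "\<And>t. t \<in> {0..T} \<Longrightarrow> u t = sol h X t \<and> v t = sol_D1 h X t \<and> w t = sol_D2 h X t"
  shows "bvp_solution T \<eta> \<alpha> \<beta> a b lam f g u"
proof -
  have h: "continuous_on {0..T} h"
    unfolding h_def by (rule continuous_on_compose2[OF f]) (auto intro!: continuous_intros cont)
  have uX: "\<And>t. t \<in> {0..T} \<Longrightarrow> u t = sol h X t" using fixed by blast
  have lin: "solves_caputo_eq T \<alpha> h u \<and>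
      a 0 * u 0 + b 0 * u T = lam 0 * (LINT s:{0..T}|lebesgue. g 0 (s, u s)) \<and>
      a 1 * caputo T (\<beta> 1) u \<eta> + b 1 * caputo T (\<beta> 1) u T = lam 1 * (LINT s:{0..T}|lebesgue. g 1 (s, u s)) \<and>
      a 2 * caputo T (\<beta> 2) u \<eta> + b 2 * caputo T (\<beta> 2) u T = lam 2 * (LINT s:{0..T}|lebesgue. g 2 (s, u s))"
    by (rule linear_bvp_iff[OF h, THEN iffD2]) (use uX in \<open>simp add: X_def\<close>)
  let ?h = "\<lambda>t. f (t, u t, caputo T (\<beta> 1) u t, caputo T (\<beta> 2) u t)"
  have heq: "?h t = h t" if "t \<in> {0..T}" for t
    using caputo_sol[OF h uX that] fixed[OF that] by (simp add: h_def)
  have "RL_integral \<alpha> ?h t = RL_integral \<alpha> h t" if "t \<in> {0..T}" for t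
    using that by (intro RL_integral_cong heq) auto
  then have "solves_caputo_eq T \<alpha> ?h u"
    using lin by (simp add: solves_caputo_eq_def)
  then show ?thesis
    using lin sol_cont_diff[OF h uX] by (simp add: bvp_solution_def)
qed

text \<open>
  In this block \<open>h\<close> has the size of a difference of right-hand sides along two triples at distance
  \<open>N\<close>, which is where the bounds are applied.
\<close>

context
  fixes \<tau> N :: real and l h :: "real \<Rightarrow> real"
  assumes \<tau>: "0 < \<tau>" "\<tau> < min 1 (\<alpha> - \<beta> 2)"
    and l: "in_Lp T (1 / \<tau>) l" and lnn: "\<And>s. s \<in> {0..T} \<Longrightarrow> 0 \<le> l s"
    and h: "continuous_on {0..T} h" and le: "\<And>s. s \<in> {0..T} \<Longrightarrow> \<bar>h s\<bar> \<le> l s * N" and N: "0 \<le> N"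
begin

lemma \<tau>_less: "i \<in> {0, 1, 2} \<Longrightarrow> \<tau> < \<alpha> - \<beta> i"
  using \<tau> \<alpha> \<beta>0 \<beta>1 \<beta>2 by auto

lemma Lp_norm_nonneg: "0 \<le> Lp_norm T p l"
  by (simp add: Lp_norm_def)

text \<open>
  The bound is monotone in the upper limit of integration. Taking \<open>s = T\<close> gives a uniform estimate;
  \<open>s = \<eta>\<close> also covers the left node \<open>0\<close> of the first boundary condition.
\<close>

lemma abs_RL_le:
  assumes i: "i \<in> {0, 1, 2}" and t: "0 \<le> t" "t \<le> s" "s \<le> T"
  shows "\<bar>RL_integral (\<alpha> - \<beta> i) h t\<bar> \<le> s powr (\<alpha> - \<beta> i - \<tau>) / Gamma (\<alpha> - \<beta> i)
    * ((1 - \<tau>) / (\<alpha> - \<beta> i - \<tau>)) powr (1 - \<tau>) * Lp_norm T (1 / \<tau>) l * N"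
proof -
  have "t \<in> {0..T}" "\<tau> < 1" using t \<tau> by auto
  from abs_RL_integral_le[OF h this(1) \<tau>(1) this(2) \<tau>_less[OF i] l le N lnn]
  have "\<bar>RL_integral (\<alpha> - \<beta> i) h t\<bar> \<le> t powr (\<alpha> - \<beta> i - \<tau>) / Gamma (\<alpha> - \<beta> i)
    * ((1 - \<tau>) / (\<alpha> - \<beta> i - \<tau>)) powr (1 - \<tau>) * Lp_norm T (1 / \<tau>) l * N" .
  also have "\<dots> \<le> s powr (\<alpha> - \<beta> i - \<tau>) / Gamma (\<alpha> - \<beta> i)
    * ((1 - \<tau>) / (\<alpha> - \<beta> i - \<tau>)) powr (1 - \<tau>) * Lp_norm T (1 / \<tau>) l * N"
    using t \<tau>_less[OF i] \<alpha>_\<beta>_pos[OF i] N Lp_norm_nonneg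
    by (intro mult_right_mono divide_right_mono powr_mono2 Gamma_real_nonneg) auto
  finally show ?thesis .
qed

lemma abs_bdry_le:
  assumes i: "i \<in> {0, 1, 2}"
  shows "\<bar>bdry h i\<bar> \<le> bdry_term T \<eta> \<alpha> \<beta> a b \<tau> i * Lp_norm T (1 / \<tau>) l * N"
proof -
  let ?c = "\<lambda>s. s powr (\<alpha> - \<beta> i - \<tau>) / Gamma (\<alpha> - \<beta> i)
    * ((1 - \<tau>) / (\<alpha> - \<beta> i - \<tau>)) powr (1 - \<tau>) * Lp_norm T (1 / \<tau>) l * N"
  have "\<bar>bdry h i\<bar> \<le> \<bar>a i\<bar> * \<bar>RL_integral (\<alpha> - \<beta> i) h (if i = 0 then 0 else \<eta>)\<bar> + \<bar>b i\<bar> * \<bar>RL_integral (\<alpha> - \<beta> i) h T\<bar>"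
    unfolding bdry_def abs_mult[symmetric] by (rule abs_triangle_ineq)
  also have "\<dots> \<le> \<bar>a i\<bar> * ?c \<eta> + \<bar>b i\<bar> * ?c T"
    using T \<eta> by (intro add_mono mult_left_mono abs_RL_le[OF i]) auto
  also have "\<dots> = bdry_term T \<eta> \<alpha> \<beta> a b \<tau> i * Lp_norm T (1 / \<tau>) l * N"
    by (simp add: bdry_term_def algebra_simps)
  finally show ?thesis .
qed

text \<open>
  Here \<open>Y\<close> is the difference of the prescribed boundary values. Each bound splits into the direct
  fractional integral and the boundary data weighted by the sensitivities; the terms with \<open>h\<close> collect
  to the constants \<open>\<Delta>0\<close>, \<open>\<Delta>1\<close>, \<open>\<Delta>2\<close>.
\<close>

lemma sol_contraction_estimates:
  assumes Y: "\<And>i. i \<in> {0, 1, 2} \<Longrightarrow> \<bar>Y i\<bar> \<le> M i * N" and t: "t \<in> {0..T}"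
  shows "\<bar>sol h (\<lambda>i. bdry h i - Y i) t\<bar>
      \<le> (\<Delta>0 T \<eta> \<alpha> \<beta> a b \<tau> * Lp_norm T (1 / \<tau>) l + (\<Sum>i=0..2. rho T \<eta> \<beta> a b i * M i)) * N"
    and "\<bar>sol_D1 h (\<lambda>i. bdry h i - Y i) t\<bar>
      \<le> (\<Delta>1 T \<eta> \<alpha> \<beta> a b \<tau> * Lp_norm T (1 / \<tau>) l + (\<Sum>i=1..2. rho_tilde T \<eta> \<beta> a b i * M i)) * N"
    and "\<bar>sol_D2 h (\<lambda>i. bdry h i - Y i) t\<bar>
      \<le> (\<Delta>2 T \<eta> \<alpha> \<beta> a b \<tau> * Lp_norm T (1 / \<tau>) l + rho_hat T \<eta> \<beta> a b 2 * M 2) * N"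
proof -
  let ?L = "Lp_norm T (1 / \<tau>) l" and ?B = "bdry_term T \<eta> \<alpha> \<beta> a b \<tau>"
  have X: "\<bar>bdry h i - Y i\<bar> \<le> (?B i * ?L + M i) * N" if "i \<in> {0, 1, 2}" for i
    using abs_triangle_ineq4[of "bdry h i" "Y i"] abs_bdry_le[OF that] Y[OF that]
    by (simp add: distrib_right)
  have tt: "0 \<le> t" "t \<le> T" using t by auto
  have i3: "i \<in> {0, 1, 2}" if "i \<in> {0..2} \<or> i \<in> {1..2}" for i :: nat using that by auto
  have "\<bar>sol h (\<lambda>i. bdry h i - Y i) t\<bar> \<le> \<bar>RL_integral \<alpha> h t\<bar> + (\<Sum>i=0..2. rho T \<eta> \<beta> a b i * \<bar>bdry h i - Y i\<bar>)"
    by (rule abs_sol_le[OF t])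
  also have "\<dots> \<le> T powr (\<alpha> - \<tau>) / Gamma \<alpha> * ((1 - \<tau>) / (\<alpha> - \<tau>)) powr (1 - \<tau>) * ?L * N
      + (\<Sum>i=0..2. rho T \<eta> \<beta> a b i * ((?B i * ?L + M i) * N))"
    using abs_RL_le[of 0 t T] tt \<beta>0
    by (intro add_mono sum_mono mult_left_mono X rho_nonneg i3) auto
  also have "\<dots> = (\<Delta>0 T \<eta> \<alpha> \<beta> a b \<tau> * ?L + (\<Sum>i=0..2. rho T \<eta> \<beta> a b i * M i)) * N"
    by (simp add: \<Delta>0_def sum_distrib_right distrib_left distrib_right sum.distrib mult.assoc)
  finally show "\<bar>sol h (\<lambda>i. bdry h i - Y i) t\<bar> \<le> (\<Delta>0 T \<eta> \<alpha> \<beta> a b \<tau> * ?L + (\<Sum>i=0..2. rho T \<eta> \<beta> a b i * M i)) * N" .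
  have "\<bar>sol_D1 h (\<lambda>i. bdry h i - Y i) t\<bar>
      \<le> \<bar>RL_integral (\<alpha> - \<beta> 1) h t\<bar> + (\<Sum>i=1..2. rho_tilde T \<eta> \<beta> a b i * \<bar>bdry h i - Y i\<bar>)"
    by (rule abs_sol_D1_le[OF t])
  also have "\<dots> \<le> T powr (\<alpha> - \<beta> 1 - \<tau>) / Gamma (\<alpha> - \<beta> 1) * ((1 - \<tau>) / (\<alpha> - \<beta> 1 - \<tau>)) powr (1 - \<tau>) * ?L * N
      + (\<Sum>i=1..2. rho_tilde T \<eta> \<beta> a b i * ((?B i * ?L + M i) * N))"
    using tt by (intro add_mono sum_mono mult_left_mono X rho_nonneg i3 abs_RL_le) auto
  also have "\<dots> = (\<Delta>1 T \<eta> \<alpha> \<beta> a b \<tau> * ?L + (\<Sum>i=1..2. rho_tilde T \<eta> \<beta> a b i * M i)) * N"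
    by (simp add: \<Delta>1_def sum_distrib_right distrib_left distrib_right sum.distrib mult.assoc)
  finally show "\<bar>sol_D1 h (\<lambda>i. bdry h i - Y i) t\<bar>
      \<le> (\<Delta>1 T \<eta> \<alpha> \<beta> a b \<tau> * ?L + (\<Sum>i=1..2. rho_tilde T \<eta> \<beta> a b i * M i)) * N" .
  have "\<bar>sol_D2 h (\<lambda>i. bdry h i - Y i) t\<bar>
      \<le> \<bar>RL_integral (\<alpha> - \<beta> 2) h t\<bar> + rho_hat T \<eta> \<beta> a b 2 * \<bar>bdry h 2 - Y 2\<bar>"
    by (rule abs_sol_D2_le[OF t])
  also have "\<dots> \<le> T powr (\<alpha> - \<beta> 2 - \<tau>) / Gamma (\<alpha> - \<beta> 2) * ((1 - \<tau>) / (\<alpha> - \<beta> 2 - \<tau>)) powr (1 - \<tau>) * ?L * N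
      + rho_hat T \<eta> \<beta> a b 2 * ((?B 2 * ?L + M 2) * N)"
    using tt by (intro add_mono mult_left_mono X rho_nonneg abs_RL_le) auto
  also have "\<dots> = (\<Delta>2 T \<eta> \<alpha> \<beta> a b \<tau> * ?L + rho_hat T \<eta> \<beta> a b 2 * M 2) * N"
    by (simp add: \<Delta>2_def algebra_simps)
  finally show "\<bar>sol_D2 h (\<lambda>i. bdry h i - Y i) t\<bar>
      \<le> (\<Delta>2 T \<eta> \<alpha> \<beta> a b \<tau> * ?L + rho_hat T \<eta> \<beta> a b 2 * M 2) * N" .
qed

end

end

theorem theorem7:
  fixes T \<eta> \<alpha> \<tau> :: real
    and \<beta> a b lam :: "nat \<Rightarrow> real"
    and f :: "real \<times> real \<times> real \<times> real \<Rightarrow> real"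
    and g :: "nat \<Rightarrow> real \<times> real \<Rightarrow> real"
    and lf :: "real \<Rightarrow> real"
    and lg :: "nat \<Rightarrow> real \<Rightarrow> real"
  assumes "T > 0" and "0 < \<eta>" and "\<eta> < T"
    and "2 < \<alpha>" and "\<alpha> \<le> 3"
    and "\<beta> 0 = 0" and "0 < \<beta> 1" and "\<beta> 1 \<le> 1" and "1 < \<beta> 2" and "\<beta> 2 \<le> 2"
    and "a 0 + b 0 \<noteq> 0"
    and "a 1 * \<eta> powr (1 - \<beta> 1) + b 1 * T powr (1 - \<beta> 1) \<noteq> 0"
    and "\<forall>i\<in>{1, 2}. a i * \<eta> powr (2 - \<beta> i) + b i * T powr (2 - \<beta> i) \<noteq> 0"
    and "continuous_on ({0..T} \<times> UNIV) f"
    and "0 < \<tau>" and "\<tau> < min 1 (\<alpha> - \<beta> 2)"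
    and "in_Lp T (1 / \<tau>) lf" and "\<forall>t\<in>{0..T}. 0 \<le> lf t"
    and "\<forall>t\<in>{0..T}. \<forall>u1 u2 u3 v1 v2 v3.
           \<bar>f (t, u1, u2, u3) - f (t, v1, v2, v3)\<bar> \<le> lf t * (\<bar>u1 - v1\<bar> + \<bar>u2 - v2\<bar> + \<bar>u3 - v3\<bar>)"
    and "\<forall>i\<in>{0, 1, 2}. continuous_on ({0..T} \<times> UNIV) (g i)"
    and "\<forall>i\<in>{0, 1, 2}. in_Lp T 1 (lg i) \<and> (\<forall>t\<in>{0..T}. 0 \<le> lg i t)"
    and "\<forall>i\<in>{0, 1, 2}. \<forall>t\<in>{0..T}. \<forall>u v. \<bar>g i (t, u) - g i (t, v)\<bar> \<le> lg i t * \<bar>u - v\<bar>"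
    and "(\<Delta>0 T \<eta> \<alpha> \<beta> a b \<tau> + \<Delta>1 T \<eta> \<alpha> \<beta> a b \<tau> + \<Delta>2 T \<eta> \<alpha> \<beta> a b \<tau>) * Lp_norm T (1 / \<tau>) lf
         + (\<Sum>i=0..2. rho T \<eta> \<beta> a b i * \<bar>lam i\<bar> * Lp_norm T 1 (lg i))
         + (\<Sum>i=1..2. rho_tilde T \<eta> \<beta> a b i * \<bar>lam i\<bar> * Lp_norm T 1 (lg i))
         + rho_hat T \<eta> \<beta> a b 2 * \<bar>lam 2\<bar> * Lp_norm T 1 (lg 2) < 1"
  shows "\<exists>u. bvp_solution T \<eta> \<alpha> \<beta> a b lam f g u \<and>
           (\<forall>v. bvp_solution T \<eta> \<alpha> \<beta> a b lam f g v \<longrightarrow> (\<forall>t\<in>{0..T}. v t = u t))"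
proof -
  interpret three_point_bvp T \<eta> \<alpha> \<beta> a b
    using assms(1-13) by unfold_locales auto
  note f = assms(14) and \<tau> = assms(15,16) and lf = assms(17)
  have lf_nn: "\<And>t. t \<in> {0..T} \<Longrightarrow> 0 \<le> lf t" using assms(18) by blast
  define L where "L = Lp_norm T (1 / \<tau>) lf"
  define M where "M i = \<bar>lam i\<bar> * Lp_norm T 1 (lg i)" for i
  define q0 where "q0 = \<Delta>0 T \<eta> \<alpha> \<beta> a b \<tau> * L + (\<Sum>i=0..2. rho T \<eta> \<beta> a b i * M i)"
  define q1 where "q1 = \<Delta>1 T \<eta> \<alpha> \<beta> a b \<tau> * L + (\<Sum>i=1..2. rho_tilde T \<eta> \<beta> a b i * M i)"
  define q2 where "q2 = \<Delta>2 T \<eta> \<alpha> \<beta> a b \<tau> * L + rho_hat T \<eta> \<beta> a b 2 * M 2"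
  have q: "q0 + q1 + q2 < 1"
    using assms(23) by (simp add: q0_def q1_def q2_def L_def M_def algebra_simps)
  have T0: "0 \<le> T" using T by simp
  \<comment> \<open>For a triple \<open>p\<close>, \<open>H p\<close> is the right-hand side along \<open>p\<close> and \<open>X p\<close> the data of the linear
      problem that it poses; \<open>\<Phi> p\<close> is its solution together with the Caputo derivatives.\<close>
  define H where "H p t = f (t, fst p t, fst (snd p) t, snd (snd p) t)"
    for p :: "(real \<Rightarrow>\<^sub>C real) \<times> (real \<Rightarrow>\<^sub>C real) \<times> (real \<Rightarrow>\<^sub>C real)" and t
  define Y where "Y p i = lam i * (LINT s:{0..T}|lebesgue. g i (s, fst p s))"
    for p :: "(real \<Rightarrow>\<^sub>C real) \<times> (real \<Rightarrow>\<^sub>C real) \<times> (real \<Rightarrow>\<^sub>C real)" and i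
  define X where "X p i = bdry (H p) i - Y p i" for p i
  define \<Phi> where "\<Phi> p = (clamp_ext T (sol (H p) (X p)), clamp_ext T (sol_D1 (H p) (X p)),
    clamp_ext T (sol_D2 (H p) (X p)))" for p
  define D where "D p r = dist (fst p) (fst r) + dist (fst (snd p)) (fst (snd r)) + dist (snd (snd p)) (snd (snd r))"
    for p r :: "(real \<Rightarrow>\<^sub>C real) \<times> (real \<Rightarrow>\<^sub>C real) \<times> (real \<Rightarrow>\<^sub>C real)"
  have H: "continuous_on {0..T} (H p)" for p
    unfolding H_def by (rule continuous_on_compose2[OF f]) (auto intro!: continuous_intros)
  note cont = continuous_on_sol[OF H]
  have contr: "D (\<Phi> p) (\<Phi> r) \<le> (q0 + q1 + q2) * D p r" for p r
  proof -
    let ?N = "D p r"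
    let ?h = "\<lambda>t. H p t - H r t"
    have N: "0 \<le> ?N" by (simp add: D_def)
    have pt: "\<bar>fst p t - fst r t\<bar> + \<bar>fst (snd p) t - fst (snd r) t\<bar> + \<bar>snd (snd p) t - snd (snd r) t\<bar> \<le> ?N" for t
      unfolding D_def using dist_bounded[of "fst p" t "fst r"]
        dist_bounded[of "fst (snd p)" t "fst (snd r)"] dist_bounded[of "snd (snd p)" t "snd (snd r)"]
      by (simp add: dist_real_def)
    have h: "continuous_on {0..T} ?h" by (intro continuous_intros H)
    have le: "\<bar>?h t\<bar> \<le> lf t * ?N" if "t \<in> {0..T}" for t
    proof -
      have "\<bar>?h t\<bar> \<le> lf t * (\<bar>fst p t - fst r t\<bar> + \<bar>fst (snd p) t - fst (snd r) t\<bar> + \<bar>snd (snd p) t - snd (snd r) t\<bar>)"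
        unfolding H_def using assms(19) that by blast
      also have "\<dots> \<le> lf t * ?N" by (intro mult_left_mono pt lf_nn that)
      finally show ?thesis .
    qed
    have Yd: "\<bar>Y p i - Y r i\<bar> \<le> M i * ?N" if "i \<in> {0, 1, 2}" for i
    proof -
      have "\<bar>(LINT s:{0..T}|lebesgue. g i (s, fst p s)) - (LINT s:{0..T}|lebesgue. g i (s, fst r s))\<bar>
          \<le> Lp_norm T 1 (lg i) * ?N"
      proof (rule abs_integral_diff_le)
        show "\<bar>fst p t - fst r t\<bar> \<le> ?N" for t using pt[of t] by linarith
      qed (use assms(20-22) that in auto)
      then show ?thesis
        unfolding Y_def M_def right_diff_distrib[symmetric] abs_mult
        by (simp only: mult.assoc) (intro mult_left_mono; simp)
    qed
    have X: "X p i - X r i = bdry ?h i - (Y p i - Y r i)" if "i \<in> {0, 1, 2}" for i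
      using bdry_diff[OF H H that, of p r] by (simp add: X_def)
    \<comment> \<open>The identity for \<open>X\<close> is available at the three relevant indices only, but the coefficients
        depend on no others.\<close>
    have coeff_X: "coeff2 (\<lambda>i. X p i - X r i) = coeff2 (\<lambda>i. bdry ?h i - (Y p i - Y r i))"
      "coeff1 (\<lambda>i. X p i - X r i) = coeff1 (\<lambda>i. bdry ?h i - (Y p i - Y r i))"
      "coeff0 (\<lambda>i. X p i - X r i) = coeff0 (\<lambda>i. bdry ?h i - (Y p i - Y r i))"
      unfolding coeff0_def coeff1_def coeff2_def using X by simp_all
    have est: "\<bar>sol ?h (\<lambda>i. bdry ?h i - (Y p i - Y r i)) t\<bar> \<le> q0 * ?N"
      "\<bar>sol_D1 ?h (\<lambda>i. bdry ?h i - (Y p i - Y r i)) t\<bar> \<le> q1 * ?N"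
      "\<bar>sol_D2 ?h (\<lambda>i. bdry ?h i - (Y p i - Y r i)) t\<bar> \<le> q2 * ?N" if "t \<in> {0..T}" for t
      unfolding q0_def q1_def q2_def L_def
      by (rule sol_contraction_estimates[OF \<tau> lf _ h _ N]; fact lf_nn le Yd that)+
    have "\<bar>sol (H p) (X p) t - sol (H r) (X r) t\<bar> \<le> q0 * ?N"
      "\<bar>sol_D1 (H p) (X p) t - sol_D1 (H r) (X r) t\<bar> \<le> q1 * ?N"
      "\<bar>sol_D2 (H p) (X p) t - sol_D2 (H r) (X r) t\<bar> \<le> q2 * ?N" if "t \<in> {0..T}" for t
      unfolding sol_diff[OF H H that]
      using est[OF that] by (simp_all only: sol_def sol_D1_def sol_D2_def coeff_X)
    then have "dist (fst (\<Phi> p)) (fst (\<Phi> r)) \<le> q0 * ?N"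
      "dist (fst (snd (\<Phi> p))) (fst (snd (\<Phi> r))) \<le> q1 * ?N"
      "dist (snd (snd (\<Phi> p))) (snd (snd (\<Phi> r))) \<le> q2 * ?N"
      unfolding \<Phi>_def fst_conv snd_conv by (intro dist_clamp_ext_le T0 cont; blast)+
    then show ?thesis by (simp add: D_def[of "\<Phi> p"] distrib_right)
  qed
  have "\<exists>!p. \<Phi> p = p"
  \<comment> \<open>The maximum supplies the nonnegativity of the contraction constant.\<close>
  proof (rule contraction_equivalent_metric[where D=D and C=3 and q="max 0 (q0 + q1 + q2)"])
    fix p r :: "(real \<Rightarrow>\<^sub>C real) \<times> (real \<Rightarrow>\<^sub>C real) \<times> (real \<Rightarrow>\<^sub>C real)"
    have "dist (snd p) (snd r) \<le> dist (fst (snd p)) (fst (snd r)) + dist (snd (snd p)) (snd (snd r))"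
      unfolding dist_prod_def by (rule sqrt_sum_squares_le_sum) auto
    moreover have "dist p r \<le> dist (fst p) (fst r) + dist (snd p) (snd r)"
      unfolding dist_prod_def[of p r] by (rule sqrt_sum_squares_le_sum) auto
    ultimately show "dist p r \<le> D p r" by (simp add: D_def)
    show "D p r \<le> 3 * dist p r"
      using dist_fst_le[of p r] dist_snd_le[of p r] dist_fst_le[of "snd p" "snd r"] dist_snd_le[of "snd p" "snd r"]
      by (simp add: D_def)
    have "0 \<le> D p r" by (simp add: D_def)
    then have "(q0 + q1 + q2) * D p r \<le> max 0 (q0 + q1 + q2) * D p r"
      by (intro mult_right_mono) auto
    then show "D (\<Phi> p) (\<Phi> r) \<le> max 0 (q0 + q1 + q2) * D p r"
      using contr[of p r] by linarith
  qed (use q in auto)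
  then obtain p where p: "\<Phi> p = p" and uniq: "\<And>r. \<Phi> r = r \<Longrightarrow> r = p" by blast
  have "bvp_solution T \<eta> \<alpha> \<beta> a b lam f g (fst p)"
  proof (rule fixed_imp_bvp_solution[OF f, where v="fst (snd p)" and w="snd (snd p)"])
    fix t assume t: "t \<in> {0..T}"
    have "fst p t = fst (\<Phi> p) t" "fst (snd p) t = fst (snd (\<Phi> p)) t" "snd (snd p) t = snd (snd (\<Phi> p)) t"
      by (simp_all only: p)
    then show "fst p t = sol (\<lambda>t. f (t, fst p t, fst (snd p) t, snd (snd p) t))
          (\<lambda>i. bdry (\<lambda>t. f (t, fst p t, fst (snd p) t, snd (snd p) t)) i
             - lam i * (LINT s:{0..T}|lebesgue. g i (s, fst p s))) t \<and>
        fst (snd p) t = sol_D1 (\<lambda>t. f (t, fst p t, fst (snd p) t, snd (snd p) t))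
          (\<lambda>i. bdry (\<lambda>t. f (t, fst p t, fst (snd p) t, snd (snd p) t)) i
             - lam i * (LINT s:{0..T}|lebesgue. g i (s, fst p s))) t \<and>
        snd (snd p) t = sol_D2 (\<lambda>t. f (t, fst p t, fst (snd p) t, snd (snd p) t))
          (\<lambda>i. bdry (\<lambda>t. f (t, fst p t, fst (snd p) t, snd (snd p) t)) i
             - lam i * (LINT s:{0..T}|lebesgue. g i (s, fst p s))) t"
      unfolding H_def[symmetric] Y_def[symmetric] X_def[symmetric]
      using t cont by (simp add: \<Phi>_def apply_clamp_ext_inside)
  qed simp_all
  moreover have "v t = fst p t" if v: "bvp_solution T \<eta> \<alpha> \<beta> a b lam f g v" and t: "t \<in> {0..T}" for v t
  proof -
    note fixpt = bvp_solution_imp_fixed[OF f v]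
    define r where "r = (clamp_ext T v, clamp_ext T (caputo T (\<beta> 1) v), clamp_ext T (caputo T (\<beta> 2) v))"
    have r: "fst r t = v t" "fst (snd r) t = caputo T (\<beta> 1) v t" "snd (snd r) t = caputo T (\<beta> 2) v t"
      if "t \<in> {0..T}" for t
      using that fixpt(1-3) by (simp_all add: r_def apply_clamp_ext_inside)
    let ?h = "\<lambda>t. f (t, v t, caputo T (\<beta> 1) v t, caputo T (\<beta> 2) v t)"
    \<comment> \<open>The constant extensions of \<open>v\<close> and its Caputo derivatives form a fixed point of \<open>\<Phi>\<close>.\<close>
    have Hr: "?h t = H r t" if "t \<in> {0..T}" for t using r[OF that] by (simp add: H_def)
    have "bdry ?h i = bdry (H r) i" for i by (rule sol_cong(4)[OF Hr t])
    moreover have "lam i * (LINT s:{0..T}|lebesgue. g i (s, v s)) = Y r i" for i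
      unfolding Y_def by (intro arg_cong[where f="(*) _"] set_lebesgue_integral_cong) (auto simp: r)
    ultimately have Xr: "(\<lambda>i. bdry ?h i - lam i * (LINT s:{0..T}|lebesgue. g i (s, v s))) = X r"
      by (simp add: X_def fun_eq_iff)
    have sol_r: "v t = sol (H r) (X r) t" "caputo T (\<beta> 1) v t = sol_D1 (H r) (X r) t"
      "caputo T (\<beta> 2) v t = sol_D2 (H r) (X r) t" if "t \<in> {0..T}" for t
      using fixpt(4)[OF that] sol_cong[OF Hr that] unfolding Xr by simp_all
    have "\<Phi> r = r"
    proof -
      have "clamp_ext T (sol (H r) (X r)) = clamp_ext T v"
        by (rule clamp_ext_cong[OF T0 cont(1) fixpt(1)]) (rule sol_r(1)[symmetric])
      moreover have "clamp_ext T (sol_D1 (H r) (X r)) = clamp_ext T (caputo T (\<beta> 1) v)"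
        by (rule clamp_ext_cong[OF T0 cont(2) fixpt(2)]) (rule sol_r(2)[symmetric])
      moreover have "clamp_ext T (sol_D2 (H r) (X r)) = clamp_ext T (caputo T (\<beta> 2) v)"
        by (rule clamp_ext_cong[OF T0 cont(3) fixpt(3)]) (rule sol_r(3)[symmetric])
      ultimately have "\<Phi> r = (clamp_ext T v, clamp_ext T (caputo T (\<beta> 1) v), clamp_ext T (caputo T (\<beta> 2) v))"
        by (simp only: \<Phi>_def)
      then show ?thesis by (simp only: r_def[symmetric])
    qed
    then show ?thesis using uniq r(1)[OF t] by metis
  qed
  ultimately show ?thesis by blast
qed

end
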